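(* Let $R$ be a locally pseudo-valuation domain (LPVD). Then $\mathrm{fPD}(R)\leq 1$.
   Context: A prime ideal $\mathfrak{p}$ of an integral domain $R$ with quotient field $K$ is strongly prime if whenever $x,y\in K$ and $xy\in\mathfrak{p}$, then $x\in\mathfrak{p}$ or $y\in\mathfrak{p}$. An integral domain is a pseudo-valuation domain (PVD) if each of its prime ideals is strongly prime. An integral domain $R$ is a locally pseudo-valuation domain (LPVD) if $R_{\mathfrak{m}}$ is a PVD for each maximal ideal $\mathfrak{m}$ of $R$. An $R$-module $M$ has a finite projective resolution if there are an integer $m\ge 0$ and an exact sequence $0\to P_m\to\dots\to P_0\to M\to 0$ with each $P_i$ finitely generated projective. The small finitistic dimension $\mathrm{fPD}(R)$ is the supremum of the projective dimensions of all $R$-modules having a finite projective resolution. *)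

theory Defs
  imports "HOL-Library.Extended_Nat" "HOL-Algebra.Ideal" "HOL-Algebra.Module"
begin

text \<open>
  The fraction \<open>a/s\<close>: the class of \<open>(a, s)\<close> in \<open>R \<times> S\<close>, where \<open>(a, s) \<sim> (b, t)\<close> iff
  \<open>u (ta - sb) = 0\<close> for some \<open>u \<in> S\<close>.
\<close>

definition fraction :: "('a, 'r) ring_scheme \<Rightarrow> 'a set \<Rightarrow> 'a \<Rightarrow> 'a \<Rightarrow> ('a \<times> 'a) set" where
  "fraction R S a s = {(b, t). b \<in> carrier R \<and> t \<in> S \<and>
     (\<exists>u\<in>S. u \<otimes>\<^bsub>R\<^esub> (t \<otimes>\<^bsub>R\<^esub> a \<ominus>\<^bsub>R\<^esub> s \<otimes>\<^bsub>R\<^esub> b) = \<zero>\<^bsub>R\<^esub>)}"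

text \<open>
  The operations are given on representatives; they are well defined when \<open>S\<close> is
  multiplicatively closed, so that each union below is the union of a single class.
\<close>

definition localization :: "('a, 'r) ring_scheme \<Rightarrow> 'a set \<Rightarrow> ('a \<times> 'a) set ring" where
  "localization R S =
    \<lparr>carrier = {fraction R S a s | a s. a \<in> carrier R \<and> s \<in> S},
     mult = (\<lambda>x y. \<Union>{fraction R S (a \<otimes>\<^bsub>R\<^esub> b) (s \<otimes>\<^bsub>R\<^esub> t) | a s b t. (a, s) \<in> x \<and> (b, t) \<in> y}),
     one = fraction R S \<one>\<^bsub>R\<^esub> \<one>\<^bsub>R\<^esub>,
     zero = fraction R S \<zero>\<^bsub>R\<^esub> \<one>\<^bsub>R\<^esub>,
     add = (\<lambda>x y. \<Union>{fraction R S (t \<otimes>\<^bsub>R\<^esub> a \<oplus>\<^bsub>R\<^esub> s \<otimes>\<^bsub>R\<^esub> b) (s \<otimes>\<^bsub>R\<^esub> t) | a s b t.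
              (a, s) \<in> x \<and> (b, t) \<in> y})\<rparr>"

definition localize_at :: "('a, 'r) ring_scheme \<Rightarrow> 'a set \<Rightarrow> ('a \<times> 'a) set ring" where
  "localize_at R p = localization R (carrier R - p)"

definition quotient_field :: "('a, 'r) ring_scheme \<Rightarrow> ('a \<times> 'a) set ring" where
  "quotient_field R = localization R (carrier R - {\<zero>\<^bsub>R\<^esub>})"

definition to_quotient_field :: "('a, 'r) ring_scheme \<Rightarrow> 'a \<Rightarrow> ('a \<times> 'a) set" where
  "to_quotient_field R a = fraction R (carrier R - {\<zero>\<^bsub>R\<^esub>}) a \<one>\<^bsub>R\<^esub>"

definition strongly_prime :: "('a, 'r) ring_scheme \<Rightarrow> 'a set \<Rightarrow> bool" where
  "strongly_prime R p \<longleftrightarrow> primeideal p R \<and>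
    (\<forall>x\<in>carrier (quotient_field R). \<forall>y\<in>carrier (quotient_field R).
       x \<otimes>\<^bsub>quotient_field R\<^esub> y \<in> to_quotient_field R ` p \<longrightarrow>
       x \<in> to_quotient_field R ` p \<or> y \<in> to_quotient_field R ` p)"

definition PVD :: "('a, 'r) ring_scheme \<Rightarrow> bool" where
  "PVD R \<longleftrightarrow> domain R \<and> (\<forall>p. primeideal p R \<longrightarrow> strongly_prime R p)"

definition LPVD :: "('a, 'r) ring_scheme \<Rightarrow> bool" where
  "LPVD R \<longleftrightarrow> domain R \<and> (\<forall>\<mm>. maximalideal \<mm> R \<longrightarrow> PVD (localize_at R \<mm>))"

definition linear_maps ::
  "('a, 'r) ring_scheme \<Rightarrow> ('a, 'm, 'x) module_scheme \<Rightarrow> ('a, 'n, 'y) module_scheme \<Rightarrow> ('m \<Rightarrow> 'n) set"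
  where
  "linear_maps R M N = {f \<in> carrier M \<rightarrow> carrier N.
     (\<forall>x\<in>carrier M. \<forall>y\<in>carrier M. f (x \<oplus>\<^bsub>M\<^esub> y) = f x \<oplus>\<^bsub>N\<^esub> f y) \<and>
     (\<forall>a\<in>carrier R. \<forall>x\<in>carrier M. f (a \<odot>\<^bsub>M\<^esub> x) = a \<odot>\<^bsub>N\<^esub> f x)}"

definition module_kernel ::
  "('a, 'm, 'x) module_scheme \<Rightarrow> ('a, 'n, 'y) module_scheme \<Rightarrow> ('m \<Rightarrow> 'n) \<Rightarrow> 'm set" where
  "module_kernel M N f = {x \<in> carrier M. f x = \<zero>\<^bsub>N\<^esub>}"

definition finitely_generated :: "('a, 'r) ring_scheme \<Rightarrow> ('a, 'm, 'x) module_scheme \<Rightarrow> bool" where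
  "finitely_generated R M \<longleftrightarrow> (\<exists>A. finite A \<and> A \<subseteq> carrier M \<and>
     (\<forall>x\<in>carrier M. \<exists>c\<in>A \<rightarrow> carrier R. x = (\<Oplus>\<^bsub>M\<^esub>y\<in>A. c y \<odot>\<^bsub>M\<^esub> y)))"

text \<open>
  Projectivity is the lifting property against surjections \<open>g : A \<rightarrow> B\<close>. A formula cannot range
  over all types, so \<open>A\<close> and \<open>B\<close> are taken with elements in \<open>'p \<Rightarrow> 'a\<close> and \<open>'p\<close>. This loses
  nothing: for \<open>A\<close> the free module of finitely supported functions on \<open>carrier P\<close> and
  \<open>B = P\<close> it makes \<open>P\<close> a direct summand of \<open>A\<close>, and hence gives the lifting property
  against surjections between modules of arbitrary types.
\<close>

definition projective :: "('a, 'r) ring_scheme \<Rightarrow> ('a, 'p) module \<Rightarrow> bool" where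
  "projective R P \<longleftrightarrow> module R P \<and>
    (\<forall>(A :: ('a, 'p \<Rightarrow> 'a) module) (B :: ('a, 'p) module) g f.
       module R A \<longrightarrow> module R B \<longrightarrow>
       g \<in> linear_maps R A B \<longrightarrow> g ` carrier A = carrier B \<longrightarrow> f \<in> linear_maps R P B \<longrightarrow>
       (\<exists>h\<in>linear_maps R P A. \<forall>x\<in>carrier P. g (h x) = f x))"

text \<open>
  An exact sequence \<open>0 \<rightarrow> P n \<rightarrow> \<dots> \<rightarrow> P 0 \<rightarrow> M \<rightarrow> 0\<close> with maps \<open>d i : P (i + 1) \<rightarrow> P i\<close> and
  \<open>e : P 0 \<rightarrow> M\<close>, continued to the left by zero modules.
\<close>

definition resolution ::
  "('a, 'r) ring_scheme \<Rightarrow> nat \<Rightarrow> (nat \<Rightarrow> ('a, 'p) module) \<Rightarrow> (nat \<Rightarrow> 'p \<Rightarrow> 'p) \<Rightarrow> ('p \<Rightarrow> 'm)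
    \<Rightarrow> ('a, 'm) module \<Rightarrow> bool" where
  "resolution R n P d e M \<longleftrightarrow>
    module R M \<and> (\<forall>i. module R (P i)) \<and> (\<forall>i>n. carrier (P i) = {\<zero>\<^bsub>P i\<^esub>}) \<and>
    e \<in> linear_maps R (P 0) M \<and> (\<forall>i. d i \<in> linear_maps R (P (Suc i)) (P i)) \<and>
    e ` carrier (P 0) = carrier M \<and>
    d 0 ` carrier (P 1) = module_kernel (P 0) M e \<and>
    (\<forall>i. d (Suc i) ` carrier (P (Suc (Suc i))) = module_kernel (P (Suc i)) (P i) (d i))"

text \<open>
  The elements of the terms of a resolution of an \<open>R\<close>-module with elements in \<open>'m\<close> are taken
  from the following type. It is large enough. The finitely supported functions form a free
  module \<open>F\<close> whose rank is an infinite cardinal at least \<open>|R|\<close> and \<open>|M|\<close>, so \<open>|F|\<close> equals that rank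
  (for \<open>R \<noteq> 0\<close>). Every finitely generated projective module is a direct summand of some
  \<open>R^k\<close> and so embeds in \<open>F\<close>. Likewise the kernel of any map from a submodule of \<open>F\<close> is again
  covered by a free submodule of \<open>F\<close>, and if \<open>M\<close> has projective dimension at most \<open>n\<close>, then
  the \<open>n\<close>-th syzygy of a resolution built in this way is projective (Schanuel) and lies in \<open>F\<close>.
\<close>

type_synonym ('a, 'm) res_elem = "'m \<times> 'a \<times> nat \<Rightarrow> 'a"

definition has_finite_projective_resolution :: "('a, 'r) ring_scheme \<Rightarrow> ('a, 'm) module \<Rightarrow> bool"
  where
  "has_finite_projective_resolution R M \<longleftrightarrow>
    (\<exists>n (P :: nat \<Rightarrow> ('a, ('a, 'm) res_elem) module) d e.
       resolution R n P d e M \<and> (\<forall>i. projective R (P i) \<and> finitely_generated R (P i)))"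

text \<open>The infimum of the empty set is \<open>\<infinity>\<close>.\<close>

definition projective_dimension :: "('a, 'r) ring_scheme \<Rightarrow> ('a, 'm) module \<Rightarrow> enat" where
  "projective_dimension R M =
    Inf {enat n | n. \<exists>(P :: nat \<Rightarrow> ('a, ('a, 'm) res_elem) module) d e.
       resolution R n P d e M \<and> (\<forall>i. projective R (P i))}"

text \<open>
  The supremum over the modules with elements in \<open>'m\<close>. Modules with a finite projective
  resolution are finitely generated, so up to isomorphism all of them occur already for
  \<open>'m = (nat \<Rightarrow> 'a) set\<close>, as quotients of the modules \<open>R^k\<close>; a bound valid for every
  \<open>'m\<close> is thus a bound for the small finitistic dimension of \<open>R\<close>.
\<close>

definition fPD :: "'m itself \<Rightarrow> ('a, 'r) ring_scheme \<Rightarrow> enat" where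
  "fPD _ R = Sup {projective_dimension R M | M :: ('a, 'm) module.
     module R M \<and> has_finite_projective_resolution R M}"

end

theory Submission
  imports Defs "HOL-Algebra.Ring_Divisibility"
begin

text \<open>
  Let \<open>P n \<rightarrow> \<dots> \<rightarrow> P 0 \<rightarrow> M\<close> be a finite resolution by finitely generated projective modules over the
  LPVD \<open>R\<close>. The point is that all syzygies, the images of the maps \<open>d i\<close>, are again finitely generated
  projective. The last of them, the kernel of \<open>P 0 \<rightarrow> M\<close>, then gives a projective resolution of length
  at most \<open>1\<close>.

  Going down from \<open>i = n\<close>, where the image is zero, consider \<open>d : N \<rightarrow> Q\<close> with \<open>N\<close> and \<open>Q\<close> finitely
  generated projective and with a finitely generated projective kernel \<open>Z\<close>. As \<open>Q\<close> is torsion-free,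
  \<open>Z\<close> is saturated in \<open>N\<close>: if \<open>a x \<in> Z\<close> with \<open>a \<noteq> 0\<close>, then \<open>x \<in> Z\<close>. Over an LPVD this forces \<open>Z\<close> to be
  a direct summand (\<open>LPVD_saturated_retraction\<close>), and the image of \<open>d\<close> is isomorphic to a complement
  (\<open>LPVD_image_dual_basis\<close>).

  The splitting comes from a property of finitely generated ideals. Over a local domain with maximal
  ideal \<open>\<mm>\<close>, the map \<open>Z \<rightarrow> N\<close> splits if and only if it is injective modulo \<open>\<mm>\<close>. If it were not, some
  \<open>x \<notin> \<mm> Z\<close> would have image in \<open>\<mm> N\<close>; saturation then gives the ideal \<open>I \<subseteq> \<mm>\<close> generated by the
  coordinates of this image the trivial inverse \<open>R : I = R\<close>. In a pseudo-valuation domain no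
  nonzero finitely generated proper ideal \<open>I\<close> has this property. Indeed strong primality of \<open>\<mm>\<close> says that for any two
  elements one of the two quotients carries \<open>\<mm>\<close> into itself, so one of the generators, \<open>y\<close>, satisfies
  \<open>(1/y) \<mm> I \<subseteq> \<mm>\<close>. Hence \<open>(1/y) \<mm> \<subseteq> R : I = R\<close>, so \<open>\<mm> = y R\<close>, so \<open>(1/y) I \<subseteq> R\<close> and \<open>1/y \<in> R : I = R\<close>,
  although \<open>y \<in> \<mm>\<close>. This is \<open>exists_dot_not_in_maximal\<close>, stated with denominators cleared, so that no
  localized modules are needed. The passage from all maximal ideals to \<open>R\<close> is \<open>unit_vectors_mem\<close>.
\<close>

section \<open>Fractions over an integral domain\<close>

locale denominators = domain R for R (structure) +
  fixes S
  assumes denom_nonzero: "S \<subseteq> carrier R - {\<zero>}"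
    and denom_one: "\<one> \<in> S"
    and denom_mult: "\<And>s t. s \<in> S \<Longrightarrow> t \<in> S \<Longrightarrow> s \<otimes> t \<in> S"
begin

lemma denom_carrier: "s \<in> S \<Longrightarrow> s \<in> carrier R"
  using denom_nonzero by blast

lemma mem_fraction_iff:
  assumes "a \<in> carrier R" "s \<in> S"
  shows "(b, t) \<in> fraction R S a s \<longleftrightarrow> b \<in> carrier R \<and> t \<in> S \<and> t \<otimes> a = s \<otimes> b"
proof -
  have "(\<exists>u\<in>S. u \<otimes> (t \<otimes> a \<ominus> s \<otimes> b) = \<zero>) \<longleftrightarrow> t \<otimes> a = s \<otimes> b"
    if bt: "b \<in> carrier R" "t \<in> S"
  proof
    assume "\<exists>u\<in>S. u \<otimes> (t \<otimes> a \<ominus> s \<otimes> b) = \<zero>"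
    then obtain u where u: "u \<in> S" "u \<otimes> (t \<otimes> a \<ominus> s \<otimes> b) = \<zero>" by blast
    have "u \<in> carrier R" "u \<noteq> \<zero>" using u(1) denom_nonzero by auto
    moreover have "t \<otimes> a \<ominus> s \<otimes> b \<in> carrier R"
      using assms bt denom_carrier by simp
    ultimately have "t \<otimes> a \<ominus> s \<otimes> b = \<zero>" using u(2) integral by blast
    then show "t \<otimes> a = s \<otimes> b" using assms bt denom_carrier by simp
  next
    assume "t \<otimes> a = s \<otimes> b"
    then have "\<one> \<otimes> (t \<otimes> a \<ominus> s \<otimes> b) = \<zero>"
      using assms bt denom_carrier by simp
    then show "\<exists>u\<in>S. u \<otimes> (t \<otimes> a \<ominus> s \<otimes> b) = \<zero>" using denom_one by blast
  qed
  then show ?thesis unfolding fraction_def by auto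
qed

lemma fraction_eq_iff:
  assumes "a \<in> carrier R" "s \<in> S" "b \<in> carrier R" "t \<in> S"
  shows "fraction R S a s = fraction R S b t \<longleftrightarrow> t \<otimes> a = s \<otimes> b"
proof
  assume "fraction R S a s = fraction R S b t"
  moreover have "(b, t) \<in> fraction R S b t" using assms by (simp add: mem_fraction_iff)
  ultimately have "(b, t) \<in> fraction R S a s" by simp
  then show "t \<otimes> a = s \<otimes> b" using assms by (simp add: mem_fraction_iff)
next
  assume eq: "t \<otimes> a = s \<otimes> b"
  have "v \<otimes> a = s \<otimes> c \<longleftrightarrow> v \<otimes> b = t \<otimes> c" if cv: "c \<in> carrier R" "v \<in> S" for c v
  proof -
    note carr = assms(1,3) cv(1) assms(2,4)[THEN denom_carrier] cv(2)[THEN denom_carrier]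
    have nz: "s \<noteq> \<zero>" "t \<noteq> \<zero>" using assms denom_nonzero by auto
    have 1: "t \<otimes> (v \<otimes> a) = s \<otimes> (v \<otimes> b)"
      using m_lcomm[of t v a] m_lcomm[of s v b] eq carr by simp
    have "v \<otimes> a = s \<otimes> c \<longleftrightarrow> t \<otimes> (v \<otimes> a) = t \<otimes> (s \<otimes> c)"
      using m_lcancel[OF nz(2)] carr by simp
    also have "\<dots> \<longleftrightarrow> s \<otimes> (v \<otimes> b) = s \<otimes> (t \<otimes> c)"
      using 1 m_lcomm[of t s c] carr by simp
    also have "\<dots> \<longleftrightarrow> v \<otimes> b = t \<otimes> c"
      using m_lcancel[OF nz(1)] carr by simp
    finally show ?thesis .
  qed
  then show "fraction R S a s = fraction R S b t"
    using assms by (auto simp: mem_fraction_iff set_eq_iff)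
qed

lemma carrier_localization:
  "carrier (localization R S) = {fraction R S a s | a s. a \<in> carrier R \<and> s \<in> S}"
  by (simp add: localization_def)

lemma one_localization: "\<one>\<^bsub>localization R S\<^esub> = fraction R S \<one> \<one>"
  and zero_localization: "\<zero>\<^bsub>localization R S\<^esub> = fraction R S \<zero> \<one>"
  by (simp_all add: localization_def)

lemma mult_localization:
  assumes "a \<in> carrier R" "s \<in> S" "b \<in> carrier R" "t \<in> S"
  shows "fraction R S a s \<otimes>\<^bsub>localization R S\<^esub> fraction R S b t = fraction R S (a \<otimes> b) (s \<otimes> t)"
proof -
  have eq: "fraction R S (a' \<otimes> b') (s' \<otimes> t') = fraction R S (a \<otimes> b) (s \<otimes> t)"
    if "(a', s') \<in> fraction R S a s" "(b', t') \<in> fraction R S b t" for a' s' b' t'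
  proof -
    have h: "a' \<in> carrier R" "s' \<in> S" "s' \<otimes> a = s \<otimes> a'" "b' \<in> carrier R" "t' \<in> S" "t' \<otimes> b = t \<otimes> b'"
      using that assms by (auto simp: mem_fraction_iff)
    have carr: "s \<in> carrier R" "t \<in> carrier R" "s' \<in> carrier R" "t' \<in> carrier R"
      using assms h denom_carrier by auto
    have "(s \<otimes> t) \<otimes> (a' \<otimes> b') = (s \<otimes> a') \<otimes> (t \<otimes> b')"
      using carr h(1,4) assms(1,3) by (simp add: m_ac)
    also have "\<dots> = (s' \<otimes> a) \<otimes> (t' \<otimes> b)" using h by simp
    also have "\<dots> = (s' \<otimes> t') \<otimes> (a \<otimes> b)"
      using carr h(1,4) assms(1,3) by (simp add: m_ac)
    finally show ?thesis
      using assms h denom_mult by (subst fraction_eq_iff) auto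
  qed
  have "(a, s) \<in> fraction R S a s" "(b, t) \<in> fraction R S b t"
    using assms by (auto simp: mem_fraction_iff)
  with eq have "{fraction R S (a \<otimes> b) (s \<otimes> t) | a' s' b' t'.
      (a', s') \<in> fraction R S a s \<and> (b', t') \<in> fraction R S b t} = {fraction R S (a \<otimes> b) (s \<otimes> t)}"
    by blast
  moreover have "{fraction R S (a' \<otimes> b') (s' \<otimes> t') | a' s' b' t'.
      (a', s') \<in> fraction R S a s \<and> (b', t') \<in> fraction R S b t}
    = {fraction R S (a \<otimes> b) (s \<otimes> t) | a' s' b' t'.
      (a', s') \<in> fraction R S a s \<and> (b', t') \<in> fraction R S b t}"
    using eq by (intro Collect_cong) metis
  ultimately show ?thesis by (simp add: localization_def)
qed

lemma add_localization:
  assumes "a \<in> carrier R" "s \<in> S" "b \<in> carrier R" "t \<in> S"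
  shows "fraction R S a s \<oplus>\<^bsub>localization R S\<^esub> fraction R S b t
    = fraction R S (t \<otimes> a \<oplus> s \<otimes> b) (s \<otimes> t)"
proof -
  have eq: "fraction R S (t' \<otimes> a' \<oplus> s' \<otimes> b') (s' \<otimes> t') = fraction R S (t \<otimes> a \<oplus> s \<otimes> b) (s \<otimes> t)"
    if "(a', s') \<in> fraction R S a s" "(b', t') \<in> fraction R S b t" for a' s' b' t'
  proof -
    have h: "a' \<in> carrier R" "s' \<in> S" "s' \<otimes> a = s \<otimes> a'" "b' \<in> carrier R" "t' \<in> S" "t' \<otimes> b = t \<otimes> b'"
      using that assms by (auto simp: mem_fraction_iff)
    have carr: "s \<in> carrier R" "t \<in> carrier R" "s' \<in> carrier R" "t' \<in> carrier R"
      using assms h denom_carrier by auto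
    have "(s \<otimes> t) \<otimes> (t' \<otimes> a' \<oplus> s' \<otimes> b') = t \<otimes> t' \<otimes> (s \<otimes> a') \<oplus> s \<otimes> s' \<otimes> (t \<otimes> b')"
      using carr h(1,4) assms(1,3) by (simp add: m_ac r_distr)
    also have "\<dots> = t \<otimes> t' \<otimes> (s' \<otimes> a) \<oplus> s \<otimes> s' \<otimes> (t' \<otimes> b)" using h by simp
    also have "\<dots> = (s' \<otimes> t') \<otimes> (t \<otimes> a \<oplus> s \<otimes> b)"
      using carr h(1,4) assms(1,3) by (simp add: m_ac r_distr)
    finally show ?thesis
      using assms h carr denom_mult by (subst fraction_eq_iff) auto
  qed
  have "(a, s) \<in> fraction R S a s" "(b, t) \<in> fraction R S b t"
    using assms by (auto simp: mem_fraction_iff)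
  with eq have "{fraction R S (t \<otimes> a \<oplus> s \<otimes> b) (s \<otimes> t) | a' s' b' t'.
      (a', s') \<in> fraction R S a s \<and> (b', t') \<in> fraction R S b t}
    = {fraction R S (t \<otimes> a \<oplus> s \<otimes> b) (s \<otimes> t)}"
    by blast
  moreover have "{fraction R S (t' \<otimes> a' \<oplus> s' \<otimes> b') (s' \<otimes> t') | a' s' b' t'.
      (a', s') \<in> fraction R S a s \<and> (b', t') \<in> fraction R S b t}
    = {fraction R S (t \<otimes> a \<oplus> s \<otimes> b) (s \<otimes> t) | a' s' b' t'.
      (a', s') \<in> fraction R S a s \<and> (b', t') \<in> fraction R S b t}"
    using eq by (intro Collect_cong) metis
  ultimately show ?thesis by (simp add: localization_def)
qed

end

section \<open>Primes and maximal ideals\<close>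

lemma (in domain) quotient_field_denominators: "denominators R (carrier R - {\<zero>})"
  by unfold_locales (auto simp: integral_iff)

lemma (in domain) prime_complement_denominators:
  assumes "primeideal p R"
  shows "denominators R (carrier R - p)"
proof -
  interpret p: primeideal p R by fact
  show ?thesis
    by unfold_locales
      (use p.one_imp_carrier p.I_notcarr p.I_prime p.zero_closed in auto)
qed

text \<open>
  Zorn's lemma on the ideals without \<open>\<one>\<close>: the union of a chain of such ideals is one again.
\<close>

lemma (in cring) exists_maximalideal:
  assumes "ideal I R" "\<one> \<notin> I"
  shows "\<exists>m. maximalideal m R \<and> I \<subseteq> m"
proof -
  let ?A = "{J. ideal J R \<and> I \<subseteq> J \<and> \<one> \<notin> J}"
  have "\<exists>M\<in>?A. \<forall>X\<in>?A. M \<subseteq> X \<longrightarrow> X = M"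
  proof (rule subset_Zorn_nonempty)
    show "?A \<noteq> {}" using assms by blast
  next
    fix C assume C: "C \<noteq> {}" "subset.chain ?A C"
    then have "subset.chain {I. ideal I R} C" unfolding pred_on.chain_def by blast
    then have "ideal (\<Union>C) R" using chain_Union_is_ideal[of C] C(1) by simp
    then show "\<Union>C \<in> ?A" using C unfolding pred_on.chain_def by blast
  qed
  then obtain M where "M \<in> ?A" and max: "\<forall>X\<in>?A. M \<subseteq> X \<longrightarrow> X = M" ..
  then have M: "ideal M R" "I \<subseteq> M" "\<one> \<notin> M" by auto
  have "maximalideal M R"
  proof (rule maximalidealI)
    show "ideal M R" "carrier R \<noteq> M" using M one_closed by auto
  next
    fix J assume J: "ideal J R" "M \<subseteq> J" "J \<subseteq> carrier R"
    show "J = M \<or> J = carrier R"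
    proof (cases "\<one> \<in> J")
      case True
      then show ?thesis using ideal.one_imp_carrier[OF J(1)] by simp
    next
      case False
      with J M(2) have "J \<in> ?A" by simp
      with max J(2) show ?thesis by simp
    qed
  qed
  with M show ?thesis by blast
qed

section \<open>Comparing elements of a pseudo-valuation domain\<close>

text \<open>
  The product of the fractions \<open>a/b\<close> and \<open>bp/a\<close> is \<open>p \<in> P\<close>, so strong primality puts one of them
  into \<open>P\<close>.
\<close>

lemma (in domain) strongly_prime_comparable:
  assumes P: "strongly_prime R P"
    and "a \<in> carrier R" "a \<noteq> \<zero>" "b \<in> carrier R" "b \<noteq> \<zero>" "p \<in> P"
  shows "(\<exists>c\<in>P. a = b \<otimes> c) \<or> (\<exists>c\<in>P. b \<otimes> p = a \<otimes> c)"
proof -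
  interpret Q: denominators R "carrier R - {\<zero>}" by (rule quotient_field_denominators)
  interpret P: primeideal P R using P by (simp add: strongly_prime_def)
  let ?K = "quotient_field R"
  let ?x = "fraction R (carrier R - {\<zero>}) a b"
  let ?y = "fraction R (carrier R - {\<zero>}) (b \<otimes> p) a"
  have p: "p \<in> carrier R" using assms(6) by (rule P.Icarr)
  have carr: "?x \<in> carrier ?K" "?y \<in> carrier ?K"
    using assms p unfolding quotient_field_def Q.carrier_localization by blast+
  have "?x \<otimes>\<^bsub>?K\<^esub> ?y = fraction R (carrier R - {\<zero>}) (a \<otimes> (b \<otimes> p)) (b \<otimes> a)"
    using assms p unfolding quotient_field_def by (simp add: Q.mult_localization)
  also have "\<dots> = to_quotient_field R p"
    using assms p unfolding to_quotient_field_def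
    by (subst Q.fraction_eq_iff) (auto simp: integral_iff m_ac)
  finally have "?x \<otimes>\<^bsub>?K\<^esub> ?y \<in> to_quotient_field R ` P" using assms(6) by simp
  with P carr have "?x \<in> to_quotient_field R ` P \<or> ?y \<in> to_quotient_field R ` P"
    unfolding strongly_prime_def by blast
  then show ?thesis
  proof
    assume "?x \<in> to_quotient_field R ` P"
    then obtain c where c: "c \<in> P" "?x = to_quotient_field R c" by blast
    then have "\<one> \<otimes> a = b \<otimes> c"
      using assms P.Icarr[OF c(1)] unfolding to_quotient_field_def
      by (subst (asm) Q.fraction_eq_iff) auto
    with c(1) assms show ?thesis by auto
  next
    assume "?y \<in> to_quotient_field R ` P"
    then obtain c where c: "c \<in> P" "?y = to_quotient_field R c" by blast
    then have "\<one> \<otimes> (b \<otimes> p) = a \<otimes> c"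
      using assms p P.Icarr[OF c(1)] unfolding to_quotient_field_def
      by (subst (asm) Q.fraction_eq_iff) auto
    with c(1) assms p show ?thesis by auto
  qed
qed

text \<open>
  Any numerator of a fraction decides whether the fraction lies in the extended ideal, because the
  denominators are outside \<open>p\<close>. So primality can be checked on numerators.
\<close>

lemma (in domain) primeideal_localize_at:
  assumes p: "primeideal p R" and L: "domain (localize_at R p)"
  shows "primeideal {fraction R (carrier R - p) a s | a s. a \<in> p \<and> s \<in> carrier R - p} (localize_at R p)"
    (is "primeideal ?P ?L")
proof -
  let ?S = "carrier R - p"
  let ?f = "fraction R ?S"
  interpret p: primeideal p R by (rule p)
  interpret denominators R ?S using p by (rule prime_complement_denominators)
  interpret L: domain ?L by (rule L)
  have carrL: "carrier ?L = {?f a s | a s. a \<in> carrier R \<and> s \<in> ?S}"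
    unfolding localize_at_def by (rule carrier_localization)
  have mult: "?f a s \<otimes>\<^bsub>?L\<^esub> ?f b t = ?f (a \<otimes> b) (s \<otimes> t)"
    if "a \<in> carrier R" "s \<in> ?S" "b \<in> carrier R" "t \<in> ?S" for a s b t
    using that unfolding localize_at_def by (rule mult_localization)
  have add: "?f a s \<oplus>\<^bsub>?L\<^esub> ?f b t = ?f (t \<otimes> a \<oplus> s \<otimes> b) (s \<otimes> t)"
    if "a \<in> carrier R" "s \<in> ?S" "b \<in> carrier R" "t \<in> ?S" for a s b t
    using that unfolding localize_at_def by (rule add_localization)
  have zero: "\<zero>\<^bsub>?L\<^esub> = ?f \<zero> \<one>" and one: "\<one>\<^bsub>?L\<^esub> = ?f \<one> \<one>"
    unfolding localize_at_def by (simp_all only: zero_localization one_localization)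
  have in_p: "a \<in> p" if "?f a s \<in> ?P" "a \<in> carrier R" "s \<in> ?S" for a s
  proof -
    have "?f a s \<in> ?P" by (rule that(1))
    then obtain b t where bt: "b \<in> p" "t \<in> ?S" "?f a s = ?f b t" by blast
    then have "t \<otimes> a = s \<otimes> b" using that p.Icarr by (subst (asm) fraction_eq_iff) auto
    also have "\<dots> \<in> p" using bt that by (simp add: p.I_l_closed)
    finally show ?thesis using p.I_prime[of t a] bt that by auto
  qed
  have minus: "\<ominus>\<^bsub>?L\<^esub> ?f a s = ?f (\<ominus> a) s" if "a \<in> carrier R" "s \<in> ?S" for a s
  proof (rule L.minus_equality)
    have "s \<otimes> (\<ominus> a) \<oplus> s \<otimes> a = \<zero>"
      using that r_distr[of "\<ominus> a" a s, symmetric] by (simp add: l_neg)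
    then show "?f (\<ominus> a) s \<oplus>\<^bsub>?L\<^esub> ?f a s = \<zero>\<^bsub>?L\<^esub>"
      using that denom_mult denom_one unfolding zero
      by (subst add) (auto simp: fraction_eq_iff)
    show "?f a s \<in> carrier ?L" "?f (\<ominus> a) s \<in> carrier ?L" using that unfolding carrL by blast+
  qed
  have closed: "x \<otimes>\<^bsub>?L\<^esub> y \<in> ?P" if xy: "x \<in> ?P" "y \<in> carrier ?L" for x y
  proof -
    obtain a s where x: "x = ?f a s" "a \<in> p" "s \<in> ?S" using xy(1) by blast
    obtain b t where y: "y = ?f b t" "b \<in> carrier R" "t \<in> ?S" using xy(2) carrL by blast
    have "x \<otimes>\<^bsub>?L\<^esub> y = ?f (a \<otimes> b) (s \<otimes> t)" using x y p.Icarr by (simp add: mult)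
    moreover have "a \<otimes> b \<in> p" "s \<otimes> t \<in> ?S" using x y denom_mult p.I_r_closed by blast+
    ultimately show ?thesis by blast
  qed
  show ?thesis
  proof (rule primeidealI2)
    show "additive_subgroup ?P ?L"
    proof (rule additive_subgroup.intro, rule L.add.subgroupI)
      show "?P \<subseteq> carrier ?L" using p.Icarr carrL by blast
      show "?P \<noteq> {}" using p.zero_closed denom_one by blast
    next
      fix x assume "x \<in> ?P"
      then obtain a s where x: "x = ?f a s" "a \<in> p" "s \<in> ?S" by blast
      then have "\<ominus>\<^bsub>?L\<^esub> x = ?f (\<ominus> a) s" "\<ominus> a \<in> p" using minus p.Icarr by auto
      with x(3) show "\<ominus>\<^bsub>?L\<^esub> x \<in> ?P" by blast
    next
      fix x y assume "x \<in> ?P" "y \<in> ?P"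
      then obtain a s b t where x: "x = ?f a s" "a \<in> p" "s \<in> ?S"
        and y: "y = ?f b t" "b \<in> p" "t \<in> ?S" by blast
      then have "x \<oplus>\<^bsub>?L\<^esub> y = ?f (t \<otimes> a \<oplus> s \<otimes> b) (s \<otimes> t)" using p.Icarr by (simp add: add)
      moreover have "t \<otimes> a \<oplus> s \<otimes> b \<in> p" "s \<otimes> t \<in> ?S"
        using x y denom_mult denom_carrier by (auto intro: p.I_l_closed)
      ultimately show "x \<oplus>\<^bsub>?L\<^esub> y \<in> ?P" by blast
    qed
    show "cring ?L" by (rule L.is_cring)
    show "x \<otimes>\<^bsub>?L\<^esub> y \<in> ?P" if "x \<in> ?P" "y \<in> carrier ?L" for x y
      using that by (rule closed)
    show "y \<otimes>\<^bsub>?L\<^esub> x \<in> ?P" if "x \<in> ?P" "y \<in> carrier ?L" for x y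
    proof -
      have "x \<in> carrier ?L" using that(1) p.Icarr carrL by blast
      then have "y \<otimes>\<^bsub>?L\<^esub> x = x \<otimes>\<^bsub>?L\<^esub> y" using that(2) by (intro L.m_comm)
      then show ?thesis using closed[OF that] by (simp only:)
    qed
    show "carrier ?L \<noteq> ?P"
    proof
      assume "carrier ?L = ?P"
      then have "?f \<one> \<one> \<in> ?P" using L.one_closed by (simp only: one)
      then have "\<one> \<in> p" using in_p denom_one by blast
      then show False using denom_one by blast
    qed
    fix x y assume xy: "x \<in> carrier ?L" "y \<in> carrier ?L" "x \<otimes>\<^bsub>?L\<^esub> y \<in> ?P"
    obtain a s where x: "x = ?f a s" "a \<in> carrier R" "s \<in> ?S" using xy(1) carrL by blast
    obtain b t where y: "y = ?f b t" "b \<in> carrier R" "t \<in> ?S" using xy(2) carrL by blast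
    have st: "s \<otimes> t \<in> ?S" using x y denom_mult by blast
    have "x \<otimes>\<^bsub>?L\<^esub> y = ?f (a \<otimes> b) (s \<otimes> t)" using x y by (simp add: mult)
    then have "?f (a \<otimes> b) (s \<otimes> t) \<in> ?P" using xy(3) by (simp only:)
    then have "a \<otimes> b \<in> p" using in_p[OF _ _ st] x y by blast
    then have "a \<in> p \<or> b \<in> p" using p.I_prime x y by blast
    then show "x \<in> ?P \<or> y \<in> ?P" using x y by blast
  qed
qed

text \<open>
  For \<open>b \<noteq> 0\<close> this says that \<open>(a/b) \<mm> \<subseteq> \<mm>\<close> for the maximal ideal \<open>\<mm>\<close> of the localization at \<open>m\<close>,
  that is, \<open>a/b\<close> lies in the overring \<open>\<mm> : \<mm>\<close>, which for a pseudo-valuation domain is a valuation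
  ring. Clearing denominators keeps the relation inside \<open>R\<close> and gives it a meaning for
  \<open>b = 0\<close> too.
\<close>

definition dominated :: "('a, 'r) ring_scheme \<Rightarrow> 'a set \<Rightarrow> 'a \<Rightarrow> 'a \<Rightarrow> bool" where
  "dominated R m a b \<longleftrightarrow>
    (\<forall>p\<in>m. \<exists>u\<in>carrier R - m. \<exists>c\<in>m. u \<otimes>\<^bsub>R\<^esub> (a \<otimes>\<^bsub>R\<^esub> p) = b \<otimes>\<^bsub>R\<^esub> c)"

text \<open>
  If \<open>a/b \<in> \<mm>\<close>, then multiplication by \<open>a/b\<close> preserves \<open>\<mm>\<close>. Otherwise strong primality of \<open>\<mm>\<close> gives
  \<open>bp/a \<in> \<mm>\<close> for every \<open>p \<in> \<mm>\<close>, so multiplication by \<open>b/a\<close> does.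
\<close>

lemma (in domain) PVD_imp_dominated_total:
  assumes m: "primeideal m R" and PVD: "PVD (localize_at R m)"
    and a: "a \<in> carrier R" and b: "b \<in> carrier R"
  shows "dominated R m a b \<or> dominated R m b a"
proof -
  let ?S = "carrier R - m"
  let ?L = "localize_at R m"
  let ?f = "fraction R ?S"
  let ?P = "{?f a s | a s. a \<in> m \<and> s \<in> ?S}"
  interpret m: primeideal m R by (rule m)
  interpret denominators R ?S using m by (rule prime_complement_denominators)
  interpret L: domain ?L using PVD by (simp add: PVD_def)
  have mult: "?f a s \<otimes>\<^bsub>?L\<^esub> ?f b t = ?f (a \<otimes> b) (s \<otimes> t)"
    if "a \<in> carrier R" "s \<in> ?S" "b \<in> carrier R" "t \<in> ?S" for a s b t
    using that unfolding localize_at_def by (rule mult_localization)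
  have strong: "strongly_prime ?L ?P"
    using PVD primeideal_localize_at[OF m L.domain_axioms] by (simp add: PVD_def)
  have zero_dominated: "dominated R m \<zero> c" if "c \<in> carrier R" for c
    unfolding dominated_def
  proof
    fix p assume "p \<in> m"
    then have "\<one> \<otimes> (\<zero> \<otimes> p) = c \<otimes> \<zero>" using that m.Icarr by simp
    then show "\<exists>u\<in>?S. \<exists>d\<in>m. u \<otimes> (\<zero> \<otimes> p) = c \<otimes> d" using denom_one m.zero_closed by blast
  qed
  have inL: "?f c \<one> \<in> carrier ?L" if "c \<in> carrier R" for c
    unfolding localize_at_def carrier_localization using that denom_one by blast
  have nz: "?f c \<one> \<noteq> \<zero>\<^bsub>?L\<^esub>" if "c \<in> carrier R" "c \<noteq> \<zero>" for c
    unfolding localize_at_def zero_localization using that denom_one by (simp add: fraction_eq_iff)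
  have clear: "\<exists>u\<in>?S. \<exists>d\<in>m. u \<otimes> x = y \<otimes> d"
    if eq: "?f x \<one> = ?f y \<one> \<otimes>\<^bsub>?L\<^esub> z" "z \<in> ?P" "x \<in> carrier R" "y \<in> carrier R" for x y z
  proof -
    obtain d u where z: "z = ?f d u" "d \<in> m" "u \<in> ?S" using eq(2) by blast
    have "?f x \<one> = ?f (y \<otimes> d) (\<one> \<otimes> u)"
      using eq z m.Icarr denom_one by (simp add: mult)
    then have "?f x \<one> = ?f (y \<otimes> d) u" using z by simp
    then have "u \<otimes> x = \<one> \<otimes> (y \<otimes> d)"
      using eq z m.Icarr denom_one by (subst (asm) fraction_eq_iff) auto
    then have "u \<otimes> x = y \<otimes> d" using eq z m.Icarr by simp
    with z show ?thesis by blast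
  qed
  show ?thesis
  proof (cases "a = \<zero> \<or> b = \<zero>")
    case True
    then show ?thesis using zero_dominated a b by blast
  next
    case False
    show ?thesis
    proof (cases "\<exists>z\<in>?P. ?f a \<one> = ?f b \<one> \<otimes>\<^bsub>?L\<^esub> z")
      case True
      then obtain u d where ud: "u \<in> ?S" "d \<in> m" "u \<otimes> a = b \<otimes> d"
        using clear[of a b] a b by blast
      have "dominated R m a b" unfolding dominated_def
      proof
        fix p assume p: "p \<in> m"
        have "u \<otimes> (a \<otimes> p) = b \<otimes> (d \<otimes> p)"
          using ud a b p m.Icarr by (simp add: m_assoc[symmetric])
        then show "\<exists>u\<in>?S. \<exists>c\<in>m. u \<otimes> (a \<otimes> p) = b \<otimes> c"
          using ud p m.I_l_closed m.Icarr by blast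
      qed
      then show ?thesis ..
    next
      case notleft: False
      have "dominated R m b a" unfolding dominated_def
      proof
        fix p assume p: "p \<in> m"
        have "?f p \<one> \<in> ?P" using p denom_one by blast
        from L.strongly_prime_comparable[OF strong inL[OF a] nz[OF a] inL[OF b] nz[OF b] this]
        obtain z where z: "z \<in> ?P" "?f b \<one> \<otimes>\<^bsub>?L\<^esub> ?f p \<one> = ?f a \<one> \<otimes>\<^bsub>?L\<^esub> z"
          using False notleft by blast
        moreover have "?f b \<one> \<otimes>\<^bsub>?L\<^esub> ?f p \<one> = ?f (b \<otimes> p) \<one>"
          using b p m.Icarr denom_one by (simp add: mult)
        ultimately show "\<exists>u\<in>?S. \<exists>c\<in>m. u \<otimes> (b \<otimes> p) = a \<otimes> c"
          using clear[of "b \<otimes> p" a z] a b p m.Icarr by simp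
      qed
      then show ?thesis ..
    qed
  qed
qed

lemma (in domain) dominated_trans:
  assumes m: "primeideal m R" and carr: "a \<in> carrier R" "b \<in> carrier R" "c \<in> carrier R"
    and ab: "dominated R m a b" and bc: "dominated R m b c"
  shows "dominated R m a c"
  unfolding dominated_def
proof
  interpret m: primeideal m R by (rule m)
  fix p assume p: "p \<in> m"
  obtain u d where u: "u \<in> carrier R - m" "d \<in> m" "u \<otimes> (a \<otimes> p) = b \<otimes> d"
    using ab p unfolding dominated_def by blast
  obtain v e where v: "v \<in> carrier R - m" "e \<in> m" "v \<otimes> (b \<otimes> d) = c \<otimes> e"
    using bc u(2) unfolding dominated_def by blast
  have "v \<otimes> u \<otimes> (a \<otimes> p) = c \<otimes> e"
    using u v carr p m.Icarr by (simp add: m_assoc)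
  moreover have "v \<otimes> u \<in> carrier R - m" using u(1) v(1) m.I_prime by blast
  ultimately show "\<exists>u\<in>carrier R - m. \<exists>e\<in>m. u \<otimes> (a \<otimes> p) = c \<otimes> e" using v(2) by blast
qed

lemma (in domain) exists_dominating:
  assumes m: "primeideal m R"
    and total: "\<And>a b. a \<in> carrier R \<Longrightarrow> b \<in> carrier R \<Longrightarrow> dominated R m a b \<or> dominated R m b a"
    and "finite J" "J \<noteq> {}" "y \<in> J \<rightarrow> carrier R"
  shows "\<exists>j\<in>J. \<forall>i\<in>J. dominated R m (y i) (y j)"
  using assms(3-5)
proof (induction rule: finite_ne_induct)
  case (singleton j)
  then show ?case using total[of "y j" "y j"] by auto
next
  case (insert i J)
  then obtain j where j: "j \<in> J" "\<forall>k\<in>J. dominated R m (y k) (y j)" by auto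
  have carr: "y k \<in> carrier R" if "k \<in> insert i J" for k using insert.prems that by blast
  show ?case
  proof (cases "dominated R m (y i) (y j)")
    case True
    with j show ?thesis by auto
  next
    case False
    then have ji: "dominated R m (y j) (y i)" using total carr j(1) by blast
    have "dominated R m (y k) (y i)" if "k \<in> J" for k
      using dominated_trans[OF m _ _ _ _ ji] j that carr by blast
    moreover have "dominated R m (y i) (y i)" using total[of "y i" "y i"] carr by auto
    ultimately show ?thesis by auto
  qed
qed

text \<open>
  The product of finitely many elements outside a prime ideal is again outside.
\<close>

lemma (in cring) common_multiplier:
  assumes m: "primeideal m R" and "finite J"
    and "t \<in> carrier R" "v \<in> J \<rightarrow> carrier R"
    and "\<And>j. j \<in> J \<Longrightarrow> \<exists>u\<in>carrier R - m. t divides u \<otimes> v j"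
  shows "\<exists>u\<in>carrier R - m. \<forall>j\<in>J. t divides u \<otimes> v j"
  using assms(2,4,5)
proof (induction rule: finite_induct)
  case empty
  interpret primeideal m R by (rule m)
  have "\<one> \<notin> m" using one_imp_carrier I_notcarr by blast
  then show ?case by auto
next
  case (insert i J)
  interpret m: primeideal m R by (rule m)
  obtain u where u: "u \<in> carrier R" "u \<notin> m" "\<forall>j\<in>J. t divides u \<otimes> v j" using insert by auto
  obtain w where w: "w \<in> carrier R" "w \<notin> m" "t divides w \<otimes> v i" using insert.prems by auto
  have "w \<otimes> u \<in> carrier R - m" using u w m.I_prime by blast
  moreover have "t divides w \<otimes> u \<otimes> v j" if j: "j \<in> insert i J" for j
  proof (cases "j = i")
    case True
    have "w \<otimes> u \<otimes> v i = u \<otimes> (w \<otimes> v i)" using u w insert.prems by (simp add: m_ac Pi_iff)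
    then show ?thesis using u w True insert.prems assms(3) by (auto intro!: divides_prod_l)
  next
    case False
    have "v j \<in> carrier R" using insert.prems j by blast
    then have "w \<otimes> u \<otimes> v j = w \<otimes> (u \<otimes> v j)" using u w by (simp add: m_assoc)
    moreover have "t divides u \<otimes> v j" using u j False by simp
    ultimately show ?thesis
      using u w \<open>v j \<in> carrier R\<close> assms(3) by (simp add: divides_prod_l)
  qed
  ultimately show ?case by blast
qed

section \<open>A saturated family of linear forms modulo a maximal ideal\<close>

definition dot :: "('a, 'r) ring_scheme \<Rightarrow> 'b set \<Rightarrow> ('b \<Rightarrow> 'a) \<Rightarrow> ('b \<Rightarrow> 'a) \<Rightarrow> 'a" where
  "dot R E v w = (\<Oplus>\<^bsub>R\<^esub>i\<in>E. v i \<otimes>\<^bsub>R\<^esub> w i)"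

lemma (in cring) dot_closed:
  "v \<in> E \<rightarrow> carrier R \<Longrightarrow> w \<in> E \<rightarrow> carrier R \<Longrightarrow> dot R E v w \<in> carrier R"
  unfolding dot_def by (rule finsum_closed) auto

lemma (in cring) dot_smult:
  assumes "finite E" "v \<in> E \<rightarrow> carrier R" "w \<in> E \<rightarrow> carrier R" "a \<in> carrier R"
  shows "dot R E v (\<lambda>i. a \<otimes> w i) = a \<otimes> dot R E v w"
proof -
  have "dot R E v (\<lambda>i. a \<otimes> w i) = (\<Oplus>i\<in>E. a \<otimes> (v i \<otimes> w i))"
    unfolding dot_def using assms by (intro finsum_cong') (auto simp: Pi_iff intro: m_lcomm)
  also have "\<dots> = a \<otimes> dot R E v w"
    unfolding dot_def using assms by (intro finsum_rdistr[symmetric]) auto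
  finally show ?thesis .
qed

lemma (in cring) dot_cong:
  "(\<And>i. i \<in> E \<Longrightarrow> v i = v' i) \<Longrightarrow> v' \<in> E \<rightarrow> carrier R \<Longrightarrow> x \<in> E \<rightarrow> carrier R
    \<Longrightarrow> dot R E v x = dot R E v' x"
  unfolding dot_def by (intro finsum_cong') auto

lemma (in cring) dot_zero_left: "x \<in> E \<rightarrow> carrier R \<Longrightarrow> dot R E (\<lambda>_. \<zero>) x = \<zero>"
  unfolding dot_def by (rule add.finprod_one_eqI) (auto simp: Pi_iff)

lemma (in cring) dot_unit_vector:
  assumes "finite E" "k \<in> E" "x \<in> E \<rightarrow> carrier R"
  shows "dot R E (\<lambda>i. if i = k then \<one> else \<zero>) x = x k"
proof -
  have "dot R E (\<lambda>i. if i = k then \<one> else \<zero>) x = (\<Oplus>i\<in>E. if k = i then x i else \<zero>)"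
    unfolding dot_def using assms by (intro finsum_cong') (auto simp: Pi_iff)
  also have "\<dots> = x k" using assms by (intro finsum_singleton) auto
  finally show ?thesis .
qed

lemma (in cring) dot_add_left:
  assumes "v \<in> E \<rightarrow> carrier R" "w \<in> E \<rightarrow> carrier R" "x \<in> E \<rightarrow> carrier R"
  shows "dot R E (\<lambda>i. v i \<oplus> w i) x = dot R E v x \<oplus> dot R E w x"
proof -
  have "dot R E (\<lambda>i. v i \<oplus> w i) x = (\<Oplus>i\<in>E. v i \<otimes> x i \<oplus> w i \<otimes> x i)"
    unfolding dot_def using assms by (intro finsum_cong') (auto simp: Pi_iff l_distr)
  also have "\<dots> = dot R E v x \<oplus> dot R E w x"
    unfolding dot_def using assms by (intro finsum_addf) auto
  finally show ?thesis .
qed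

lemma (in cring) dot_smult_left:
  assumes "finite E" "v \<in> E \<rightarrow> carrier R" "x \<in> E \<rightarrow> carrier R" "a \<in> carrier R"
  shows "dot R E (\<lambda>i. a \<otimes> v i) x = a \<otimes> dot R E v x"
proof -
  have "dot R E (\<lambda>i. a \<otimes> v i) x = (\<Oplus>i\<in>E. a \<otimes> (v i \<otimes> x i))"
    unfolding dot_def using assms by (intro finsum_cong') (auto simp: Pi_iff m_assoc)
  also have "\<dots> = a \<otimes> dot R E v x"
    unfolding dot_def using assms by (intro finsum_rdistr[symmetric]) auto
  finally show ?thesis .
qed

lemma (in cring) dot_minus_left:
  assumes "finite E" "v \<in> E \<rightarrow> carrier R" "w \<in> E \<rightarrow> carrier R" "x \<in> E \<rightarrow> carrier R"
  shows "dot R E (\<lambda>i. v i \<ominus> w i) x = dot R E v x \<ominus> dot R E w x"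
proof -
  have vc: "v i \<in> carrier R" "w i \<in> carrier R" if "i \<in> E" for i using assms that by auto
  have "dot R E (\<lambda>i. v i \<ominus> w i) x = dot R E (\<lambda>i. v i \<oplus> (\<ominus> \<one>) \<otimes> w i) x"
    using assms vc by (intro dot_cong) (auto simp: minus_eq l_minus)
  also have "\<dots> = dot R E v x \<oplus> dot R E (\<lambda>i. (\<ominus> \<one>) \<otimes> w i) x"
    using assms vc by (intro dot_add_left) auto
  also have "dot R E (\<lambda>i. (\<ominus> \<one>) \<otimes> w i) x = (\<ominus> \<one>) \<otimes> dot R E w x"
    using assms by (intro dot_smult_left) auto
  finally show ?thesis using assms by (simp add: minus_eq l_minus dot_closed)
qed

text \<open>
  The one place where pseudo-valuation domains enter. View the vectors in \<open>V\<close> as the rows of a matrix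
  \<open>A\<close>. The hypothesis \<open>saturated\<close> says that \<open>A\<close> reflects divisibility by every scalar \<open>t\<close>; the value
  \<open>t = 0\<close> makes \<open>A\<close> injective. The conclusion is that \<open>A\<close> stays injective modulo \<open>m\<close>.

  Suppose that all entries \<open>y v\<close> of \<open>A x\<close> lie in \<open>m\<close> although \<open>x k\<close> does not. If a fraction \<open>p/t\<close> maps
  all \<open>y v\<close> into the local ring, then \<open>t\<close> divides \<open>A (p x)\<close>, hence \<open>p x k\<close>, up to denominators outside
  \<open>m\<close>; so \<open>p/t\<close> is in the local ring itself (\<open>scaled\<close>). Let \<open>y w\<close> dominate all other entries. For
  \<open>p \<in> m\<close> the fraction \<open>p/(y w)\<close> maps all entries into the local ring, so \<open>y w\<close> locally divides every
  element of \<open>m\<close> (\<open>absorbs\<close>). In particular it divides all entries, so \<open>1/(y w)\<close> is also in the local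
  ring, which contradicts \<open>y w \<in> m\<close>.
\<close>

lemma (in domain) exists_dot_not_in_maximal:
  assumes m: "primeideal m R"
    and total: "\<And>a b. a \<in> carrier R \<Longrightarrow> b \<in> carrier R \<Longrightarrow> dominated R m a b \<or> dominated R m b a"
    and fin: "finite E" "finite V" and V: "V \<subseteq> E \<rightarrow> carrier R"
    and saturated: "\<And>t x k. t \<in> carrier R \<Longrightarrow> x \<in> E \<rightarrow> carrier R \<Longrightarrow>
      \<forall>v\<in>V. t divides dot R E v x \<Longrightarrow> k \<in> E \<Longrightarrow> t divides x k"
    and x: "x \<in> E \<rightarrow> carrier R" and k: "k \<in> E" "x k \<notin> m"
  shows "\<exists>v\<in>V. dot R E v x \<notin> m"
proof (rule ccontr)
  assume neg: "\<not> ?thesis"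
  interpret m: primeideal m R by (rule m)
  define y where "y v = dot R E v x" for v
  have ym: "y v \<in> m" if "v \<in> V" for v using neg that by (auto simp: y_def)
  have yc: "y v \<in> carrier R" if "v \<in> V" for v using ym that m.Icarr by blast
  have xk: "x k \<in> carrier R" using x k by blast
  have scaled: "\<exists>s\<in>carrier R - m. t divides s \<otimes> p"
    if t: "t \<in> carrier R" and p: "p \<in> carrier R"
      and div: "\<And>v. v \<in> V \<Longrightarrow> \<exists>u\<in>carrier R - m. t divides u \<otimes> (y v \<otimes> p)" for t p
  proof -
    have "\<exists>u\<in>carrier R - m. \<forall>v\<in>V. t divides u \<otimes> (y v \<otimes> p)"
    proof (rule common_multiplier[OF m fin(2) t])
      show "(\<lambda>v. y v \<otimes> p) \<in> V \<rightarrow> carrier R" using yc p by simp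
    qed (rule div)
    then obtain u where u: "u \<in> carrier R - m" "\<And>v. v \<in> V \<Longrightarrow> t divides u \<otimes> (y v \<otimes> p)" by blast
    have up: "u \<otimes> p \<in> carrier R" using u p by simp
    have "t divides dot R E v (\<lambda>i. u \<otimes> p \<otimes> x i)" if v: "v \<in> V" for v
    proof -
      have "dot R E v (\<lambda>i. u \<otimes> p \<otimes> x i) = u \<otimes> p \<otimes> y v"
        unfolding y_def using v V by (intro dot_smult fin x up) auto
      also have "\<dots> = u \<otimes> (y v \<otimes> p)" using u p yc[OF v] by (simp add: m_ac)
      finally show ?thesis using u(2)[OF v] by simp
    qed
    then have "t divides u \<otimes> p \<otimes> x k"
      using saturated[OF t, of "\<lambda>i. u \<otimes> p \<otimes> x i" k] x up k by blast
    moreover have "u \<otimes> p \<otimes> x k = u \<otimes> x k \<otimes> p" using u p xk by (simp add: m_ac)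
    ultimately have "t divides u \<otimes> x k \<otimes> p" by simp
    moreover have "u \<otimes> x k \<in> carrier R - m" using u xk k m.I_prime by blast
    ultimately show ?thesis by blast
  qed
  have "V \<noteq> {}"
  proof
    assume "V = {}"
    then have "\<zero> divides x k" using saturated[of \<zero> x k] x k by simp
    then have "x k = \<zero>" using dividesD by force
    then show False using k by simp
  qed
  then obtain w where w: "w \<in> V" "\<And>v. v \<in> V \<Longrightarrow> dominated R m (y v) (y w)"
    using exists_dominating[OF m total fin(2), of y] yc by blast
  have absorbs: "\<exists>s\<in>carrier R - m. y w divides s \<otimes> p" if p: "p \<in> m" for p
  proof (rule scaled)
    show "y w \<in> carrier R" "p \<in> carrier R" using w yc p m.Icarr by auto
    fix v assume "v \<in> V"
    then obtain u c where u: "u \<in> carrier R - m" "c \<in> m" "u \<otimes> (y v \<otimes> p) = y w \<otimes> c"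
      using w(2) p unfolding dominated_def by blast
    then have "y w divides u \<otimes> (y v \<otimes> p)" using m.Icarr by (intro dividesI') auto
    with u(1) show "\<exists>u\<in>carrier R - m. y w divides u \<otimes> (y v \<otimes> p)" by blast
  qed
  have "\<exists>s\<in>carrier R - m. y w divides s \<otimes> \<one>"
  proof (rule scaled)
    show "y w \<in> carrier R" "\<one> \<in> carrier R" using w yc by auto
    fix v assume "v \<in> V"
    then show "\<exists>u\<in>carrier R - m. y w divides u \<otimes> (y v \<otimes> \<one>)"
      using absorbs[OF ym] yc by simp
  qed
  then obtain s where s: "s \<in> carrier R" "s \<notin> m" and "y w divides s \<otimes> \<one>" by blast
  then obtain c where c: "c \<in> carrier R" "s \<otimes> \<one> = y w \<otimes> c" by (elim dividesE)
  then have "s = y w \<otimes> c" using s by simp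
  also have "\<dots> \<in> m" using ym[OF w(1)] c(1) by (rule m.I_r_closed)
  finally show False using s by simp
qed

section \<open>Elimination over the local rings\<close>

text \<open>
  Submodules of \<open>R\<^sup>E\<close>. The vectors are total functions of which only the values on \<open>E\<close> count, so
  membership has to be invariant under changes outside \<open>E\<close>.
\<close>

definition vector_submodule :: "('a, 'r) ring_scheme \<Rightarrow> 'b set \<Rightarrow> ('b \<Rightarrow> 'a) set \<Rightarrow> bool" where
  "vector_submodule R E W \<longleftrightarrow> W \<subseteq> E \<rightarrow> carrier R \<and>
    (\<forall>v\<in>W. \<forall>w. (\<forall>i\<in>E. w i = v i) \<longrightarrow> w \<in> W) \<and>
    (\<lambda>_. \<zero>\<^bsub>R\<^esub>) \<in> W \<and>
    (\<forall>v\<in>W. \<forall>w\<in>W. (\<lambda>i. v i \<oplus>\<^bsub>R\<^esub> w i) \<in> W) \<and>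
    (\<forall>a\<in>carrier R. \<forall>v\<in>W. (\<lambda>i. a \<otimes>\<^bsub>R\<^esub> v i) \<in> W)"

lemma (in cring) vector_submodule_lincomb:
  assumes W: "vector_submodule R E W" and "finite K"
    and "c \<in> K \<rightarrow> carrier R" "f \<in> K \<rightarrow> W"
  shows "(\<lambda>i. \<Oplus>k\<in>K. c k \<otimes> f k i) \<in> W"
  using assms(2-4)
proof (induction rule: finite_induct)
  case empty
  then show ?case using W by (simp add: vector_submodule_def)
next
  case (insert k K)
  have sub: "W \<subseteq> E \<rightarrow> carrier R" using W by (simp add: vector_submodule_def)
  let ?w = "\<lambda>i. c k \<otimes> f k i \<oplus> (\<Oplus>k\<in>K. c k \<otimes> f k i)"
  have "(\<lambda>i. c k \<otimes> f k i) \<in> W" "(\<lambda>i. \<Oplus>k\<in>K. c k \<otimes> f k i) \<in> W"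
    using W insert by (auto simp: vector_submodule_def)
  then have w: "?w \<in> W" using W by (simp add: vector_submodule_def)
  have eq: "(\<Oplus>l\<in>insert k K. c l \<otimes> f l i) = ?w i" if "i \<in> E" for i
    using insert sub that by (intro finsum_insert) (auto simp: Pi_iff subset_eq)
  from W have "\<forall>v\<in>W. \<forall>w. (\<forall>i\<in>E. w i = v i) \<longrightarrow> w \<in> W"
    by (simp add: vector_submodule_def)
  from this[rule_format, OF w] eq show ?case by simp
qed

text \<open>
  Gaussian elimination over the local ring at \<open>m\<close> without divisions: the common pivot \<open>s\<close> is outside
  \<open>m\<close> and would be scaled to \<open>1\<close> there. For \<open>K = E\<close> it shows that \<open>W\<close> is locally all of \<open>R\<^sup>E\<close>.
\<close>

lemma (in cring) local_dual_vectors: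
  assumes m: "primeideal m R" and W: "vector_submodule R E W" and fin: "finite E"
    and separating: "\<And>x k. x \<in> E \<rightarrow> carrier R \<Longrightarrow> k \<in> E \<Longrightarrow> x k \<notin> m \<Longrightarrow> \<exists>w\<in>W. dot R E w x \<notin> m"
    and "K \<subseteq> E"
  shows "\<exists>s\<in>carrier R - m. \<exists>f\<in>K \<rightarrow> W. \<forall>k\<in>K. \<forall>i\<in>K. f k i = (if i = k then s else \<zero>)"
  using finite_subset[OF \<open>K \<subseteq> E\<close> fin] \<open>K \<subseteq> E\<close>
proof (induction rule: finite_induct)
  case empty
  interpret primeideal m R by (rule m)
  have "\<one> \<notin> m" using one_imp_carrier I_notcarr by blast
  then show ?case by auto
next
  case (insert e K)
  interpret m: primeideal m R by (rule m)
  have sub: "W \<subseteq> E \<rightarrow> carrier R"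
    and add: "\<And>v w. v \<in> W \<Longrightarrow> w \<in> W \<Longrightarrow> (\<lambda>i. v i \<oplus> w i) \<in> W"
    and smult: "\<And>a v. a \<in> carrier R \<Longrightarrow> v \<in> W \<Longrightarrow> (\<lambda>i. a \<otimes> v i) \<in> W"
    using W by (auto simp: vector_submodule_def)
  have Wc: "w i \<in> carrier R" if "w \<in> W" "i \<in> E" for w i using sub that by blast
  obtain s f where s: "s \<in> carrier R" "s \<notin> m" and f: "f \<in> K \<rightarrow> W"
    and fs: "\<And>k i. k \<in> K \<Longrightarrow> i \<in> K \<Longrightarrow> f k i = (if i = k then s else \<zero>)"
    using insert by (auto simp: Bex_def)
  have e: "e \<in> E" and KE: "K \<subseteq> E" using insert by auto
  have fW: "f k \<in> W" if "k \<in> K" for k using f that by blast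
  have fc: "f k i \<in> carrier R" if "k \<in> K" "i \<in> E" for k i using fW Wc that by blast
  \<comment> \<open>The vector on which every \<open>f k\<close> vanishes: pairing with \<open>x\<close> is, up to the factor \<open>s\<close>, reading
      off the \<open>e\<close>-th entry after the entries in \<open>K\<close> have been eliminated.\<close>
  define x where "x i = (if i = e then s else if i \<in> K then \<ominus> f i e else \<zero>)" for i
  have xc: "x \<in> E \<rightarrow> carrier R" using s fc e by (auto simp: x_def)
  have "x e \<notin> m" using s by (simp add: x_def)
  then obtain g where g: "g \<in> W" "dot R E g x \<notin> m" using separating[OF xc e] by blast
  have gc: "g i \<in> carrier R" if "i \<in> E" for i using g Wc that by blast
  define q where "q = dot R E g x"
  \<comment> \<open>\<open>g\<close> with its entries in \<open>K\<close> eliminated; its new pivot at \<open>e\<close> is \<open>q\<close>.\<close>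
  define h where "h i = s \<otimes> g i \<oplus> (\<Oplus>k\<in>K. (\<ominus> g k) \<otimes> f k i)" for i
  have h: "h \<in> W" unfolding h_def
    using s g gc KE insert by (intro add smult vector_submodule_lincomb[OF W] f) auto
  have q: "q \<in> carrier R" "q \<notin> m"
    using g gc xc unfolding q_def by (auto intro: dot_closed)
  have hK: "h i = \<zero>" if i: "i \<in> K" for i
  proof -
    have "(\<Oplus>k\<in>K. (\<ominus> g k) \<otimes> f k i) = (\<Oplus>k\<in>K. if i = k then (\<ominus> g k) \<otimes> s else \<zero>)"
      using i s gc KE fs by (intro finsum_cong') auto
    also have "\<dots> = (\<ominus> g i) \<otimes> s"
      using i insert.hyps gc KE s by (intro finsum_singleton) auto
    finally show ?thesis
      using gc[of i] i KE s by (simp add: h_def l_minus r_minus m_comm r_neg subset_eq)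
  qed
  have he: "h e = q"
  proof -
    have "q = (\<Oplus>i\<in>insert e K. g i \<otimes> x i)"
      unfolding q_def dot_def
    proof (rule add.finprod_mono_neutral_cong_right)
      show "(\<lambda>i. g i \<otimes> x i) \<in> E \<rightarrow> carrier R" using gc xc by auto
      show "g i \<otimes> x i = \<zero>" if "i \<in> E - insert e K" for i using that gc by (simp add: x_def)
    qed (use fin insert.prems in auto)
    also have "\<dots> = g e \<otimes> s \<oplus> (\<Oplus>k\<in>K. g k \<otimes> x k)"
    proof (subst finsum_insert)
      show "(\<lambda>i. g i \<otimes> x i) \<in> K \<rightarrow> carrier R" using gc xc KE by auto
      show "g e \<otimes> x e \<in> carrier R" using gc xc e by auto
    qed (use insert.hyps in \<open>simp_all add: x_def\<close>)
    also have "(\<Oplus>k\<in>K. g k \<otimes> x k) = (\<Oplus>k\<in>K. (\<ominus> g k) \<otimes> f k e)"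
      using insert.hyps gc fc e KE
      by (intro finsum_cong') (auto simp: x_def l_minus r_minus subset_eq)
    finally show ?thesis using gc e s by (simp add: h_def m_comm)
  qed
  define f' where "f' k = (if k = e then (\<lambda>i. s \<otimes> h i)
    else (\<lambda>i. q \<otimes> f k i \<oplus> (\<ominus> f k e) \<otimes> h i))" for k
  have "f' \<in> insert e K \<rightarrow> W"
    using s q h fW fc e by (auto simp: f'_def intro!: add smult)
  moreover have "f' k i = (if i = k then s \<otimes> q else \<zero>)"
    if ki: "k \<in> insert e K" "i \<in> insert e K" for k i
  proof (cases "k = e")
    case True
    then show ?thesis using ki s q hK he by (auto simp: f'_def)
  next
    case False
    then have k: "k \<in> K" using ki by simp
    show ?thesis
    proof (cases "i = e")
      case True
      then show ?thesis using k False s q fc[OF k e] he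
        by (simp add: f'_def l_minus r_minus m_comm r_neg)
    next
      case ie: False
      then show ?thesis using k ki False s q fc[OF k e] hK fs[OF k, of i]
        by (auto simp: f'_def m_comm)
    qed
  qed
  moreover have "s \<otimes> q \<in> carrier R - m" using s q m.I_prime by blast
  ultimately show ?case by blast
qed

text \<open>
  The scalars \<open>s\<close> for which \<open>s\<close> times the \<open>k\<close>-th unit vector is in \<open>W\<close> form an ideal. Elimination at a
  maximal ideal \<open>m\<close> produces such an \<open>s\<close> outside \<open>m\<close>, so no maximal ideal contains this ideal.
\<close>

lemma (in cring) unit_vectors_mem:
  assumes W: "vector_submodule R E W" and fin: "finite E"
    and separating: "\<And>m x k. maximalideal m R \<Longrightarrow> x \<in> E \<rightarrow> carrier R \<Longrightarrow> k \<in> E \<Longrightarrow> x k \<notin> m \<Longrightarrow>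
      \<exists>w\<in>W. dot R E w x \<notin> m"
    and k: "k \<in> E"
  shows "(\<lambda>i. if i = k then \<one> else \<zero>) \<in> W"
proof -
  have ext: "w \<in> W" if "v \<in> W" "\<forall>i\<in>E. w i = v i" for v w
    using W that by (auto simp: vector_submodule_def)
  define J where "J = {s \<in> carrier R. (\<lambda>i. if i = k then s else \<zero>) \<in> W}"
  have J: "ideal J R"
  proof (rule idealI)
    show "ring R" by (rule ring_axioms)
    have mult: "a \<otimes> s \<in> J" if "s \<in> J" "a \<in> carrier R" for a s
    proof -
      have "(\<lambda>i. a \<otimes> (if i = k then s else \<zero>)) \<in> W"
        using W that by (auto simp: J_def vector_submodule_def)
      then have "(\<lambda>i. if i = k then a \<otimes> s else \<zero>) \<in> W"
        by (rule ext) (use that in auto)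
      then show ?thesis using that by (simp add: J_def)
    qed
    then show "a \<otimes> s \<in> J" if "s \<in> J" "a \<in> carrier R" for a s using that .
    show "s \<otimes> a \<in> J" if "s \<in> J" "a \<in> carrier R" for a s
      using mult[OF that] that by (simp add: J_def m_comm)
    show "subgroup J (add_monoid R)"
    proof (rule add.subgroupI)
      show "J \<subseteq> carrier R" by (auto simp: J_def)
      have "\<zero> \<in> J" using W by (simp add: J_def vector_submodule_def)
      then show "J \<noteq> {}" by blast
      show "\<ominus> s \<in> J" if "s \<in> J" for s
      proof -
        have "s \<in> carrier R" using that by (simp add: J_def)
        then have "\<ominus> s = (\<ominus> \<one>) \<otimes> s" by (simp add: l_minus)
        then show ?thesis using mult[OF that, of "\<ominus> \<one>"] by simp
      qed
      show "s \<oplus> t \<in> J" if "s \<in> J" "t \<in> J" for s t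
      proof -
        have "(\<lambda>i. (if i = k then s else \<zero>) \<oplus> (if i = k then t else \<zero>)) \<in> W"
          using W that by (auto simp: J_def vector_submodule_def)
        then have "(\<lambda>i. if i = k then s \<oplus> t else \<zero>) \<in> W"
          by (rule ext) auto
        then show ?thesis using that by (simp add: J_def)
      qed
    qed
  qed
  have "\<one> \<in> J"
  proof (rule ccontr)
    assume "\<one> \<notin> J"
    then obtain m where m: "maximalideal m R" "J \<subseteq> m" using exists_maximalideal[OF J] by blast
    have "\<exists>s\<in>carrier R - m. \<exists>f\<in>E \<rightarrow> W. \<forall>k\<in>E. \<forall>i\<in>E. f k i = (if i = k then s else \<zero>)"
      using maximalideal_prime[OF m(1)] W fin separating[OF m(1)] order_refl
      by (rule local_dual_vectors)
    then obtain s where s: "s \<in> carrier R - m"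
      and "\<exists>f\<in>E \<rightarrow> W. \<forall>k\<in>E. \<forall>i\<in>E. f k i = (if i = k then s else \<zero>)" ..
    then obtain f where f: "f \<in> E \<rightarrow> W"
      and fs: "\<forall>k\<in>E. \<forall>i\<in>E. f k i = (if i = k then s else \<zero>)" by (elim bexE)
    have "f k \<in> W" using f k by blast
    then have "(\<lambda>i. if i = k then s else \<zero>) \<in> W" by (rule ext) (use fs k in auto)
    then have "s \<in> J" using s by (simp add: J_def)
    then show False using s m by blast
  qed
  then show ?thesis by (simp add: J_def)
qed

section \<open>Linear maps\<close>

lemma linear_maps_closed: "f \<in> linear_maps R M N \<Longrightarrow> x \<in> carrier M \<Longrightarrow> f x \<in> carrier N"
  and linear_maps_add: "f \<in> linear_maps R M N \<Longrightarrow> x \<in> carrier M \<Longrightarrow> y \<in> carrier M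
    \<Longrightarrow> f (x \<oplus>\<^bsub>M\<^esub> y) = f x \<oplus>\<^bsub>N\<^esub> f y"
  and linear_maps_smult: "f \<in> linear_maps R M N \<Longrightarrow> a \<in> carrier R \<Longrightarrow> x \<in> carrier M
    \<Longrightarrow> f (a \<odot>\<^bsub>M\<^esub> x) = a \<odot>\<^bsub>N\<^esub> f x"
  by (auto simp: linear_maps_def)

lemma linear_mapsI:
  assumes "\<And>x. x \<in> carrier M \<Longrightarrow> f x \<in> carrier N"
    and "\<And>x y. x \<in> carrier M \<Longrightarrow> y \<in> carrier M \<Longrightarrow> f (x \<oplus>\<^bsub>M\<^esub> y) = f x \<oplus>\<^bsub>N\<^esub> f y"
    and "\<And>a x. a \<in> carrier R \<Longrightarrow> x \<in> carrier M \<Longrightarrow> f (a \<odot>\<^bsub>M\<^esub> x) = a \<odot>\<^bsub>N\<^esub> f x"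
  shows "f \<in> linear_maps R M N"
  using assms by (auto simp: linear_maps_def)

lemma linear_maps_comp:
  "f \<in> linear_maps R M N \<Longrightarrow> g \<in> linear_maps R N Q \<Longrightarrow> (\<lambda>x. g (f x)) \<in> linear_maps R M Q"
  by (auto simp: linear_maps_def Pi_iff)

lemma linear_maps_zero:
  assumes "module R M" "module R N" "f \<in> linear_maps R M N"
  shows "f \<zero>\<^bsub>M\<^esub> = \<zero>\<^bsub>N\<^esub>"
proof -
  interpret M: module R M by fact
  interpret N: module R N by fact
  have "f (\<zero>\<^bsub>R\<^esub> \<odot>\<^bsub>M\<^esub> \<zero>\<^bsub>M\<^esub>) = \<zero>\<^bsub>R\<^esub> \<odot>\<^bsub>N\<^esub> f \<zero>\<^bsub>M\<^esub>"
    by (rule linear_maps_smult[OF assms(3)]) auto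
  then show ?thesis using linear_maps_closed[OF assms(3)] by simp
qed

lemma linear_maps_minus:
  assumes "module R M" "module R N" "f \<in> linear_maps R M N" "x \<in> carrier M" "y \<in> carrier M"
  shows "f (x \<ominus>\<^bsub>M\<^esub> y) = f x \<ominus>\<^bsub>N\<^esub> f y"
proof -
  interpret M: module R M by fact
  interpret N: module R N by fact
  note cl = linear_maps_closed[OF assms(3)]
  have "f (x \<ominus>\<^bsub>M\<^esub> y) \<oplus>\<^bsub>N\<^esub> f y = f (x \<ominus>\<^bsub>M\<^esub> y \<oplus>\<^bsub>M\<^esub> y)"
    using assms by (intro linear_maps_add[OF assms(3), symmetric]) auto
  also have "x \<ominus>\<^bsub>M\<^esub> y \<oplus>\<^bsub>M\<^esub> y = x"
    using assms by (simp add: M.minus_eq M.add.m_assoc M.l_neg)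
  finally have "f x = f (x \<ominus>\<^bsub>M\<^esub> y) \<oplus>\<^bsub>N\<^esub> f y" ..
  then show ?thesis
    using assms cl by (simp add: N.minus_eq N.add.m_assoc N.r_neg)
qed

lemma linear_maps_finsum:
  assumes "module R M" "module R N" "f \<in> linear_maps R M N" "finite E" "g \<in> E \<rightarrow> carrier M"
  shows "f (\<Oplus>\<^bsub>M\<^esub>i\<in>E. g i) = (\<Oplus>\<^bsub>N\<^esub>i\<in>E. f (g i))"
  using assms(4,5)
proof (induction rule: finite_induct)
  interpret M: module R M by fact
  interpret N: module R N by fact
  {
    case empty
    show ?case using linear_maps_zero[OF assms(1-3)] by simp
  next
    case (insert i E)
    then have "f (\<Oplus>\<^bsub>M\<^esub>i\<in>insert i E. g i) = f (g i \<oplus>\<^bsub>M\<^esub> (\<Oplus>\<^bsub>M\<^esub>i\<in>E. g i))"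
      by (subst M.finsum_insert) auto
    also have "\<dots> = f (g i) \<oplus>\<^bsub>N\<^esub> f (\<Oplus>\<^bsub>M\<^esub>i\<in>E. g i)"
      using insert.prems by (intro linear_maps_add[OF assms(3)] M.finsum_closed) auto
    also have "\<dots> = (\<Oplus>\<^bsub>N\<^esub>i\<in>insert i E. f (g i))"
      using insert linear_maps_closed[OF assms(3)] by (subst N.finsum_insert) (auto simp: Pi_iff)
    finally show ?case .
  }
qed

definition regular_module :: "('a, 'r) ring_scheme \<Rightarrow> ('a, 'a) module" where
  "regular_module R = \<lparr>carrier = carrier R, monoid.mult = monoid.mult R, one = one R, zero = zero R, add = add R,
    smult = monoid.mult R\<rparr>"

lemma regular_module_simps [simp]:
  "carrier (regular_module R) = carrier R" "\<zero>\<^bsub>regular_module R\<^esub> = \<zero>\<^bsub>R\<^esub>"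
  "x \<oplus>\<^bsub>regular_module R\<^esub> y = x \<oplus>\<^bsub>R\<^esub> y" "x \<odot>\<^bsub>regular_module R\<^esub> y = x \<otimes>\<^bsub>R\<^esub> y"
  "finsum (regular_module R) f E = finsum R f E"
  by (simp_all add: regular_module_def finsum_def finprod_def comp_def)

lemma (in cring) regular_module: "module R (regular_module R)"
proof (rule moduleI)
  show "cring R" by (rule is_cring)
  show "abelian_group (regular_module R)"
  proof (rule abelian_groupI)
    fix x assume "x \<in> carrier (regular_module R)"
    then show "\<exists>y\<in>carrier (regular_module R).
        y \<oplus>\<^bsub>regular_module R\<^esub> x = \<zero>\<^bsub>regular_module R\<^esub>"
      by (intro bexI[of _ "\<ominus> x"]) (simp_all add: l_neg)
  qed (simp_all add: a_ac)
qed (simp_all add: l_distr r_distr m_assoc)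

text \<open>
  The free module \<open>R\<^sup>E\<close>. Its elements vanish outside \<open>E\<close>, so that they are equal as functions as soon
  as their coordinates agree.
\<close>

definition free_module :: "('a, 'r) ring_scheme \<Rightarrow> 'b set \<Rightarrow> ('a, 'b \<Rightarrow> 'a) module" where
  "free_module R E = \<lparr>carrier = {f. \<forall>i. if i \<in> E then f i \<in> carrier R else f i = \<zero>\<^bsub>R\<^esub>},
    monoid.mult = (\<lambda>f g i. f i \<otimes>\<^bsub>R\<^esub> g i), one = (\<lambda>i. if i \<in> E then \<one>\<^bsub>R\<^esub> else \<zero>\<^bsub>R\<^esub>), zero = (\<lambda>_. \<zero>\<^bsub>R\<^esub>),
    add = (\<lambda>f g i. f i \<oplus>\<^bsub>R\<^esub> g i), smult = (\<lambda>a f i. a \<otimes>\<^bsub>R\<^esub> f i)\<rparr>"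

lemma (in cring) free_module: "module R (free_module R E)"
proof (rule moduleI)
  let ?F = "free_module R E"
  have carr: "f i \<in> carrier R" if "f \<in> carrier ?F" for f i
    using that by (cases "i \<in> E") (auto simp: free_module_def dest: spec[of _ i])
  show "cring R" by (rule is_cring)
  show "abelian_group ?F"
  proof (rule abelian_groupI)
    fix f assume f: "f \<in> carrier ?F"
    then have "(\<lambda>i. \<ominus> f i) \<in> carrier ?F" by (auto simp: free_module_def)
    moreover have "(\<lambda>i. \<ominus> f i) \<oplus>\<^bsub>?F\<^esub> f = \<zero>\<^bsub>?F\<^esub>"
      using carr[OF f] by (simp add: free_module_def l_neg)
    ultimately show "\<exists>g\<in>carrier ?F. g \<oplus>\<^bsub>?F\<^esub> f = \<zero>\<^bsub>?F\<^esub>" by blast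
  next
    fix f g h assume "f \<in> carrier ?F" "g \<in> carrier ?F" "h \<in> carrier ?F"
    note c = this[THEN carr]
    show "f \<oplus>\<^bsub>?F\<^esub> g \<oplus>\<^bsub>?F\<^esub> h = f \<oplus>\<^bsub>?F\<^esub> (g \<oplus>\<^bsub>?F\<^esub> h)"
      using c by (simp add: free_module_def a_assoc)
  next
    fix f g assume fg: "f \<in> carrier ?F" "g \<in> carrier ?F"
    note c = this[THEN carr]
    show "f \<oplus>\<^bsub>?F\<^esub> g = g \<oplus>\<^bsub>?F\<^esub> f" using c by (simp add: free_module_def a_comm)
    show "f \<oplus>\<^bsub>?F\<^esub> g \<in> carrier ?F" using fg by (auto simp: free_module_def)
  next
    show "\<zero>\<^bsub>?F\<^esub> \<in> carrier ?F" by (simp add: free_module_def)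
    fix f assume "f \<in> carrier ?F"
    then show "\<zero>\<^bsub>?F\<^esub> \<oplus>\<^bsub>?F\<^esub> f = f" using carr by (simp add: free_module_def)
  qed
  fix f assume f: "f \<in> carrier ?F"
  show "\<one> \<odot>\<^bsub>?F\<^esub> f = f" using carr[OF f] by (simp add: free_module_def)
  fix a assume a: "a \<in> carrier R"
  show "a \<odot>\<^bsub>?F\<^esub> f \<in> carrier ?F" using a f by (auto simp: free_module_def)
  show "a \<odot>\<^bsub>?F\<^esub> (f \<oplus>\<^bsub>?F\<^esub> g) = a \<odot>\<^bsub>?F\<^esub> f \<oplus>\<^bsub>?F\<^esub> a \<odot>\<^bsub>?F\<^esub> g"
    if "g \<in> carrier ?F" for g
    using a carr[OF f] carr[OF that] by (simp add: free_module_def r_distr)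
  fix b assume b: "b \<in> carrier R"
  show "(a \<oplus> b) \<odot>\<^bsub>?F\<^esub> f = a \<odot>\<^bsub>?F\<^esub> f \<oplus>\<^bsub>?F\<^esub> b \<odot>\<^bsub>?F\<^esub> f"
    using a b carr[OF f] by (simp add: free_module_def l_distr)
  show "a \<otimes> b \<odot>\<^bsub>?F\<^esub> f = a \<odot>\<^bsub>?F\<^esub> (b \<odot>\<^bsub>?F\<^esub> f)"
    using a b carr[OF f] by (simp add: free_module_def m_assoc)
qed

lemma lincomb_linear:
  assumes "module R N" "module R M" "finite E"
    and p: "\<And>i. i \<in> E \<Longrightarrow> p i \<in> linear_maps R N (regular_module R)" and e: "e \<in> E \<rightarrow> carrier M"
  shows "(\<lambda>x. \<Oplus>\<^bsub>M\<^esub>i\<in>E. p i x \<odot>\<^bsub>M\<^esub> e i) \<in> linear_maps R N M"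
proof (rule linear_mapsI)
  interpret N: module R N by fact
  interpret M: module R M by fact
  have pc: "p i x \<in> carrier R" if "i \<in> E" "x \<in> carrier N" for i x
    using linear_maps_closed[OF p] that by fastforce
  have ec: "e i \<in> carrier M" if "i \<in> E" for i using e that by blast
  fix x assume x: "x \<in> carrier N"
  show "(\<Oplus>\<^bsub>M\<^esub>i\<in>E. p i x \<odot>\<^bsub>M\<^esub> e i) \<in> carrier M"
    using pc ec x by (intro M.finsum_closed) auto
  show "(\<Oplus>\<^bsub>M\<^esub>i\<in>E. p i (x \<oplus>\<^bsub>N\<^esub> y) \<odot>\<^bsub>M\<^esub> e i)
      = (\<Oplus>\<^bsub>M\<^esub>i\<in>E. p i x \<odot>\<^bsub>M\<^esub> e i) \<oplus>\<^bsub>M\<^esub> (\<Oplus>\<^bsub>M\<^esub>i\<in>E. p i y \<odot>\<^bsub>M\<^esub> e i)"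
    if y: "y \<in> carrier N" for y
  proof -
    have "(\<Oplus>\<^bsub>M\<^esub>i\<in>E. p i (x \<oplus>\<^bsub>N\<^esub> y) \<odot>\<^bsub>M\<^esub> e i)
        = (\<Oplus>\<^bsub>M\<^esub>i\<in>E. p i x \<odot>\<^bsub>M\<^esub> e i \<oplus>\<^bsub>M\<^esub> p i y \<odot>\<^bsub>M\<^esub> e i)"
      using pc ec x y by (intro M.finsum_cong') (auto simp: linear_maps_add[OF p] M.smult_l_distr)
    also have "\<dots> = (\<Oplus>\<^bsub>M\<^esub>i\<in>E. p i x \<odot>\<^bsub>M\<^esub> e i) \<oplus>\<^bsub>M\<^esub> (\<Oplus>\<^bsub>M\<^esub>i\<in>E. p i y \<odot>\<^bsub>M\<^esub> e i)"
      using pc ec x y by (intro M.finsum_addf) auto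
    finally show ?thesis .
  qed
  show "(\<Oplus>\<^bsub>M\<^esub>i\<in>E. p i (a \<odot>\<^bsub>N\<^esub> x) \<odot>\<^bsub>M\<^esub> e i) = a \<odot>\<^bsub>M\<^esub> (\<Oplus>\<^bsub>M\<^esub>i\<in>E. p i x \<odot>\<^bsub>M\<^esub> e i)"
    if a: "a \<in> carrier R" for a
  proof -
    have "(\<Oplus>\<^bsub>M\<^esub>i\<in>E. p i (a \<odot>\<^bsub>N\<^esub> x) \<odot>\<^bsub>M\<^esub> e i) = (\<Oplus>\<^bsub>M\<^esub>i\<in>E. a \<odot>\<^bsub>M\<^esub> (p i x \<odot>\<^bsub>M\<^esub> e i))"
      using pc ec x a by (intro M.finsum_cong') (auto simp: linear_maps_smult[OF p] M.smult_assoc1)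
    also have "\<dots> = a \<odot>\<^bsub>M\<^esub> (\<Oplus>\<^bsub>M\<^esub>i\<in>E. p i x \<odot>\<^bsub>M\<^esub> e i)"
      using assms(3) pc ec x a by (intro M.finsum_smult_ldistr[symmetric]) auto
    finally show ?thesis .
  qed
qed

section \<open>Dual bases\<close>

text \<open>
  A finite dual basis, which exists exactly for the finitely generated projective modules. The
  generators are indexed, and may repeat, so that they can be pushed forward along a linear map that
  is not injective.
\<close>

definition dual_basis :: "('a, 'r) ring_scheme \<Rightarrow> ('a, 'p, 'x) module_scheme \<Rightarrow> 'i set
    \<Rightarrow> ('i \<Rightarrow> 'p) \<Rightarrow> ('i \<Rightarrow> 'p \<Rightarrow> 'a) \<Rightarrow> bool" where
  "dual_basis R P E e \<phi> \<longleftrightarrow> finite E \<and> e \<in> E \<rightarrow> carrier P \<and>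
    (\<forall>i\<in>E. \<phi> i \<in> linear_maps R P (regular_module R)) \<and>
    (\<forall>x\<in>carrier P. x = (\<Oplus>\<^bsub>P\<^esub>i\<in>E. \<phi> i x \<odot>\<^bsub>P\<^esub> e i))"

text \<open>
  A finite generating set \<open>E\<close> gives a surjection from \<open>R\<^sup>E\<close>; the coordinates of a section of it are the
  functionals.
\<close>

lemma dual_basis_of_projective:
  fixes P :: "('a, 'p) module"
  assumes "projective R P" "finitely_generated R P"
  shows "\<exists>(E :: 'p set) e \<phi>. dual_basis R P E e \<phi>"
proof -
  interpret P: module R P using assms(1) by (simp add: projective_def)
  obtain E where E: "finite E" "E \<subseteq> carrier P"
    and gen: "\<And>x. x \<in> carrier P \<Longrightarrow> \<exists>c\<in>E \<rightarrow> carrier R. x = (\<Oplus>\<^bsub>P\<^esub>y\<in>E. c y \<odot>\<^bsub>P\<^esub> y)"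
    using assms(2) unfolding finitely_generated_def by blast
  let ?F = "free_module R E"
  interpret F: module R ?F by (rule P.R.free_module)
  let ?g = "\<lambda>f. \<Oplus>\<^bsub>P\<^esub>y\<in>E. f y \<odot>\<^bsub>P\<^esub> y"
  have coord: "(\<lambda>f. f y) \<in> linear_maps R ?F (regular_module R)" if "y \<in> E" for y
    by (rule linear_mapsI) (use that in \<open>auto simp: free_module_def\<close>)
  have g: "?g \<in> linear_maps R ?F P"
    using F.module_axioms P.module_axioms E(1) coord
    by (rule lincomb_linear[where p = "\<lambda>y f. f y" and e = "\<lambda>y. y"]) (use E(2) in auto)
  have surj: "?g ` carrier ?F = carrier P"
  proof
    show "?g ` carrier ?F \<subseteq> carrier P" using linear_maps_closed[OF g] by blast
    show "carrier P \<subseteq> ?g ` carrier ?F"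
    proof
      fix x assume "x \<in> carrier P"
      then obtain c where c: "c \<in> E \<rightarrow> carrier R" "x = (\<Oplus>\<^bsub>P\<^esub>y\<in>E. c y \<odot>\<^bsub>P\<^esub> y)" using gen by blast
      let ?c = "\<lambda>y. if y \<in> E then c y else \<zero>\<^bsub>R\<^esub>"
      have mem: "?c \<in> carrier ?F" using c(1) by (auto simp: free_module_def)
      have "?g ?c = x" unfolding c(2)
        using c(1) E(2) by (intro P.M.finsum_cong') auto
      then show "x \<in> ?g ` carrier ?F" using imageI[OF mem, of ?g] by (simp only:)
    qed
  qed
  have id: "(\<lambda>x. x) \<in> linear_maps R P P" by (rule linear_mapsI) auto
  have "\<exists>h\<in>linear_maps R P ?F. \<forall>x\<in>carrier P. ?g (h x) = x"
    by (rule assms(1)[unfolded projective_def, THEN conjunct2, rule_format,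
      OF F.module_axioms P.module_axioms g surj id])
  then obtain h where h: "h \<in> linear_maps R P ?F" "\<forall>x\<in>carrier P. ?g (h x) = x" ..
  have "dual_basis R P E (\<lambda>y. y) (\<lambda>y x. h x y)"
    unfolding dual_basis_def using E h(2) linear_maps_comp[OF h(1) coord] by auto
  then show ?thesis by blast
qed

text \<open>
  Lift the images of the generators and combine the lifts with the coordinates as coefficients.
\<close>

lemma projective_of_dual_basis:
  fixes P :: "('a, 'p) module"
  assumes P: "module R P" and db: "dual_basis R P E e \<phi>"
  shows "projective R P"
  unfolding projective_def
proof (intro conjI allI impI P)
  fix A :: "('a, 'p \<Rightarrow> 'a) module" and B :: "('a, 'p) module" and g f
  assume A: "module R A" and B: "module R B" and g: "g \<in> linear_maps R A B"
    and surj: "g ` carrier A = carrier B" and f: "f \<in> linear_maps R P B"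
  interpret P: module R P by (rule P)
  interpret A: module R A by (rule A)
  interpret B: module R B by (rule B)
  have E: "finite E" "e \<in> E \<rightarrow> carrier P" and phi: "\<And>i. i \<in> E \<Longrightarrow> \<phi> i \<in> linear_maps R P (regular_module R)"
    and expand: "\<And>x. x \<in> carrier P \<Longrightarrow> (\<Oplus>\<^bsub>P\<^esub>i\<in>E. \<phi> i x \<odot>\<^bsub>P\<^esub> e i) = x"
    using db by (auto simp: dual_basis_def)
  have ec: "e i \<in> carrier P" if "i \<in> E" for i using E that by blast
  have pc: "\<phi> i x \<in> carrier R" if "i \<in> E" "x \<in> carrier P" for i x
    using linear_maps_closed[OF phi] that by fastforce
  define a where "a i = inv_into (carrier A) g (f (e i))" for i
  have "f (e i) \<in> g ` carrier A" if "i \<in> E" for i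
    unfolding surj by (rule linear_maps_closed[OF f ec[OF that]])
  then have a: "a i \<in> carrier A" "g (a i) = f (e i)" if "i \<in> E" for i
    using that unfolding a_def by (simp_all add: inv_into_into f_inv_into_f)
  let ?h = "\<lambda>x. \<Oplus>\<^bsub>A\<^esub>i\<in>E. \<phi> i x \<odot>\<^bsub>A\<^esub> a i"
  have "?h \<in> linear_maps R P A" by (rule lincomb_linear[OF P A E(1) phi]) (use a in auto)
  moreover have "g (?h x) = f x" if x: "x \<in> carrier P" for x
  proof -
    have "g (?h x) = (\<Oplus>\<^bsub>B\<^esub>i\<in>E. g (\<phi> i x \<odot>\<^bsub>A\<^esub> a i))"
      using a pc x by (intro linear_maps_finsum[OF A B g E(1)]) auto
    also have "\<dots> = (\<Oplus>\<^bsub>B\<^esub>i\<in>E. f (\<phi> i x \<odot>\<^bsub>P\<^esub> e i))"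
      using a pc ec x linear_maps_closed[OF f]
      by (intro B.finsum_cong') (auto simp: linear_maps_smult[OF g] linear_maps_smult[OF f])
    also have "\<dots> = f x"
      using pc ec x by (subst linear_maps_finsum[OF P B f E(1), symmetric]) (auto simp: expand)
    finally show ?thesis .
  qed
  ultimately show "\<exists>h\<in>linear_maps R P A. \<forall>x\<in>carrier P. g (h x) = f x" by (intro bexI[of _ ?h] ballI)
qed

text \<open>
  The coordinates take values in a domain, so they kill torsion.
\<close>

lemma (in domain) dual_basis_torsion_free:
  assumes P: "module R P" and db: "dual_basis R P E e \<phi>"
    and "a \<in> carrier R" "a \<noteq> \<zero>" "x \<in> carrier P" "a \<odot>\<^bsub>P\<^esub> x = \<zero>\<^bsub>P\<^esub>"
  shows "x = \<zero>\<^bsub>P\<^esub>"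
proof -
  interpret P: module R P by (rule P)
  have E: "finite E" "e \<in> E \<rightarrow> carrier P" and phi: "\<And>i. i \<in> E \<Longrightarrow> \<phi> i \<in> linear_maps R P (regular_module R)"
    and expand: "x = (\<Oplus>\<^bsub>P\<^esub>i\<in>E. \<phi> i x \<odot>\<^bsub>P\<^esub> e i)"
    using db assms(5) by (auto simp: dual_basis_def)
  have "\<phi> i x = \<zero>" if i: "i \<in> E" for i
  proof -
    have "a \<otimes> \<phi> i x = \<phi> i (a \<odot>\<^bsub>P\<^esub> x)"
      using linear_maps_smult[OF phi[OF i]] assms(3,5) by simp
    also have "\<dots> = \<zero>"
      using linear_maps_zero[OF P regular_module phi[OF i]] assms(6) by simp
    finally show ?thesis
      using linear_maps_closed[OF phi[OF i]] assms(3-5) integral by fastforce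
  qed
  then have "(\<Oplus>\<^bsub>P\<^esub>i\<in>E. \<phi> i x \<odot>\<^bsub>P\<^esub> e i) = (\<Oplus>\<^bsub>P\<^esub>i\<in>E. \<zero>\<^bsub>P\<^esub>)"
    using E(2) by (intro P.M.finsum_cong') (auto simp: Pi_iff)
  then show ?thesis using expand by simp
qed

lemma dual_basis_zero_module:
  assumes "module R P" "carrier P = {\<zero>\<^bsub>P\<^esub>}"
  shows "dual_basis R P {} e \<phi>"
proof -
  interpret module R P by fact
  show ?thesis using assms(2) by (simp add: dual_basis_def)
qed

lemma image_is_module:
  assumes "module R M" "module R N" "f \<in> linear_maps R M N"
  shows "module R (N\<lparr>carrier := f ` carrier M\<rparr>)"
proof -
  interpret M: module R M by fact
  interpret N: module R N by fact
  have "submodule (f ` carrier M) R N"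
  proof (rule N.submoduleI)
    show "f ` carrier M \<subseteq> carrier N" using linear_maps_closed[OF assms(3)] by blast
    show "\<zero>\<^bsub>N\<^esub> \<in> f ` carrier M" using linear_maps_zero[OF assms] by (metis M.M.zero_closed imageI)
    show "y \<oplus>\<^bsub>N\<^esub> z \<in> f ` carrier M" if "y \<in> f ` carrier M" "z \<in> f ` carrier M" for y z
      using that linear_maps_add[OF assms(3), symmetric] by auto
    show smult: "a \<odot>\<^bsub>N\<^esub> y \<in> f ` carrier M" if "a \<in> carrier R" "y \<in> f ` carrier M" for a y
      using that linear_maps_smult[OF assms(3), symmetric] by auto
    show "\<ominus>\<^bsub>N\<^esub> y \<in> f ` carrier M" if "y \<in> f ` carrier M" for y
    proof -
      have "\<ominus>\<^bsub>N\<^esub> y = (\<ominus>\<^bsub>R\<^esub> \<one>\<^bsub>R\<^esub>) \<odot>\<^bsub>N\<^esub> y"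
        using that linear_maps_closed[OF assms(3)] by (auto simp: N.smult_l_minus)
      then show ?thesis using smult[OF _ that] by simp
    qed
  qed
  then show ?thesis by (rule submodule.submodule_is_module) fact
qed

text \<open>
  The first isomorphism theorem, with the image in place of the quotient by the kernel.
\<close>

lemma linear_map_factors_through_image:
  assumes N: "module R N" and Q: "module R Q" and M: "module R M"
    and d: "d \<in> linear_maps R N Q" and f: "f \<in> linear_maps R N M"
    and ker: "\<And>x. x \<in> carrier N \<Longrightarrow> d x = \<zero>\<^bsub>Q\<^esub> \<Longrightarrow> f x = \<zero>\<^bsub>M\<^esub>"
  shows "\<exists>f'\<in>linear_maps R (Q\<lparr>carrier := d ` carrier N\<rparr>) M. \<forall>x\<in>carrier N. f' (d x) = f x"
proof -
  interpret N: module R N by (rule N)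
  interpret Q: module R Q by (rule Q)
  interpret M: module R M by (rule M)
  note dc = linear_maps_closed[OF d] and fc = linear_maps_closed[OF f]
  define f' where "f' y = f (inv_into (carrier N) d y)" for y
  have f': "f' (d x) = f x" if x: "x \<in> carrier N" for x
  proof -
    let ?x = "inv_into (carrier N) d (d x)"
    have x': "?x \<in> carrier N" "d ?x = d x"
      using x by (auto intro: inv_into_into f_inv_into_f)
    have "d (?x \<ominus>\<^bsub>N\<^esub> x) = \<zero>\<^bsub>Q\<^esub>"
      using linear_maps_minus[OF N Q d] x x' dc by (simp add: Q.M.minus_eq Q.r_neg)
    then have "f ?x \<ominus>\<^bsub>M\<^esub> f x = \<zero>\<^bsub>M\<^esub>"
      using ker[of "?x \<ominus>\<^bsub>N\<^esub> x"] linear_maps_minus[OF N M f] x x' by simp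
    moreover have "f ?x = f ?x \<ominus>\<^bsub>M\<^esub> f x \<oplus>\<^bsub>M\<^esub> f x"
      using fc[OF x] fc[OF x'(1)] by (simp add: M.M.minus_eq M.M.a_assoc M.M.l_neg)
    ultimately show ?thesis using fc[OF x] by (simp add: f'_def)
  qed
  have "f' \<in> linear_maps R (Q\<lparr>carrier := d ` carrier N\<rparr>) M"
  proof (rule linear_mapsI)
    fix y assume "y \<in> carrier (Q\<lparr>carrier := d ` carrier N\<rparr>)"
    then obtain x where x: "x \<in> carrier N" "y = d x" by auto
    show "f' y \<in> carrier M" using x f' fc by simp
    show "f' (a \<odot>\<^bsub>Q\<lparr>carrier := d ` carrier N\<rparr>\<^esub> y) = a \<odot>\<^bsub>M\<^esub> f' y" if "a \<in> carrier R" for a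
      using x that f' linear_maps_smult[OF f] by (simp add: linear_maps_smult[OF d, symmetric])
    fix z assume "z \<in> carrier (Q\<lparr>carrier := d ` carrier N\<rparr>)"
    then obtain w where w: "w \<in> carrier N" "z = d w" by auto
    show "f' (y \<oplus>\<^bsub>Q\<lparr>carrier := d ` carrier N\<rparr>\<^esub> z) = f' y \<oplus>\<^bsub>M\<^esub> f' z"
      using x w f' linear_maps_add[OF f] by (simp add: linear_maps_add[OF d, symmetric])
  qed
  with f' show ?thesis by blast
qed

section \<open>Retractions onto saturated submodules\<close>

lemma (in cring) dot_functional:
  assumes M: "module R M" and "finite E" and p: "p \<in> linear_maps R M (regular_module R)"
    and e: "e \<in> E \<rightarrow> carrier M" and x: "x \<in> E \<rightarrow> carrier R"
  shows "dot R E (\<lambda>i. p (e i)) x = p (\<Oplus>\<^bsub>M\<^esub>i\<in>E. x i \<odot>\<^bsub>M\<^esub> e i)"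
proof -
  interpret M: module R M by (rule M)
  have c: "e i \<in> carrier M" "x i \<in> carrier R" "p (e i) \<in> carrier R" if "i \<in> E" for i
    using that e x linear_maps_closed[OF p, of "e i"] by (auto simp: Pi_iff)
  have "p (\<Oplus>\<^bsub>M\<^esub>i\<in>E. x i \<odot>\<^bsub>M\<^esub> e i) = (\<Oplus>i\<in>E. p (x i \<odot>\<^bsub>M\<^esub> e i))"
    using c linear_maps_finsum[OF M regular_module p assms(2), of "\<lambda>i. x i \<odot>\<^bsub>M\<^esub> e i"] by simp
  also have "\<dots> = dot R E (\<lambda>i. p (e i)) x"
    unfolding dot_def using c
    by (intro finsum_cong') (auto simp: linear_maps_smult[OF p] m_comm)
  finally show ?thesis ..
qed

lemma (in cring) functional_ops:
  assumes M: "module R M"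
  shows functional_zero: "(\<lambda>_. \<zero>) \<in> linear_maps R M (regular_module R)"
    and functional_add: "p \<in> linear_maps R M (regular_module R) \<Longrightarrow>
      q \<in> linear_maps R M (regular_module R) \<Longrightarrow> (\<lambda>x. p x \<oplus> q x) \<in> linear_maps R M (regular_module R)"
    and functional_smult: "a \<in> carrier R \<Longrightarrow> p \<in> linear_maps R M (regular_module R) \<Longrightarrow>
      (\<lambda>x. a \<otimes> p x) \<in> linear_maps R M (regular_module R)"
proof -
  interpret M: module R M by (rule M)
  show "(\<lambda>_. \<zero>) \<in> linear_maps R M (regular_module R)" by (rule linear_mapsI) auto
  have c: "p x \<in> carrier R" if "p \<in> linear_maps R M (regular_module R)" "x \<in> carrier M" for p x
    using linear_maps_closed[OF that] by simp
  show "(\<lambda>x. p x \<oplus> q x) \<in> linear_maps R M (regular_module R)"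
    if p: "p \<in> linear_maps R M (regular_module R)" and q: "q \<in> linear_maps R M (regular_module R)"
    using c[OF p] c[OF q]
    by (intro linear_mapsI)
      (simp_all add: linear_maps_add[OF p] linear_maps_add[OF q] linear_maps_smult[OF p]
        linear_maps_smult[OF q] r_distr a_ac)
  show "(\<lambda>x. a \<otimes> p x) \<in> linear_maps R M (regular_module R)"
    if a: "a \<in> carrier R" and p: "p \<in> linear_maps R M (regular_module R)"
    using c[OF p] a
    by (intro linear_mapsI)
      (simp_all add: linear_maps_add[OF p] linear_maps_smult[OF p] r_distr m_lcomm)
qed

text \<open>
  It is enough to extend each coordinate functional \<open>\<phi> k\<close> from \<open>H\<close> to \<open>N\<close>. The vectors \<open>w\<close> for which
  the combination of the \<open>\<phi> i\<close> with coefficients \<open>w i\<close> extends form a submodule \<open>W\<close> of \<open>R\<^sup>E\<close>, and the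
  claim is that \<open>W\<close> contains the unit vectors. By elimination it suffices to find a finite saturated
  family \<open>V\<close> in \<open>W\<close>. Two kinds of vectors make it up.

  \<^item> The restrictions to \<open>H\<close> of the coordinates of \<open>N\<close>. For \<open>z = \<Sum> x i e i\<close> these detect divisibility
    of \<open>z\<close> in \<open>N\<close>, which is divisibility in \<open>H\<close> because \<open>H\<close> is saturated.
  \<^item> The vectors with \<open>i\<close>-th entry \<open>\<delta> i l - \<phi> l (e i)\<close>. They come from relations among the \<open>\<phi> i\<close>, so the
    corresponding combination is the zero functional. They detect divisibility of \<open>x l - \<phi> l z\<close>, the
    difference between an arbitrary coefficient vector of \<open>z\<close> and the one given by the dual basis.
\<close>

lemma LPVD_saturated_retraction:
  fixes R (structure)
  assumes R: "LPVD R" and N: "module R N"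
    and H: "H \<subseteq> carrier N" and Z: "module R (N\<lparr>carrier := H\<rparr>)"
    and dbN: "dual_basis R N G g \<psi>" and dbZ: "dual_basis R (N\<lparr>carrier := H\<rparr>) E e \<phi>"
    and saturated: "\<And>a x. a \<in> carrier R \<Longrightarrow> a \<noteq> \<zero>\<^bsub>R\<^esub> \<Longrightarrow> x \<in> carrier N \<Longrightarrow> a \<odot>\<^bsub>N\<^esub> x \<in> H \<Longrightarrow> x \<in> H"
  shows "\<exists>r\<in>linear_maps R N (N\<lparr>carrier := H\<rparr>). \<forall>z\<in>H. r z = z"
proof -
  let ?Z = "N\<lparr>carrier := H\<rparr>"
  let ?R = "regular_module R"
  interpret domain R using R by (simp add: LPVD_def)
  interpret N: module R N by (rule N)
  interpret Z: module R ?Z by (rule Z)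
  have G: "finite G" and g: "\<And>j. j \<in> G \<Longrightarrow> g j \<in> carrier N"
    and psi: "\<And>j. j \<in> G \<Longrightarrow> \<psi> j \<in> linear_maps R N ?R"
    and expandN: "\<And>x. x \<in> carrier N \<Longrightarrow> (\<Oplus>\<^bsub>N\<^esub>j\<in>G. \<psi> j x \<odot>\<^bsub>N\<^esub> g j) = x"
    using dbN by (auto simp: dual_basis_def)
  have E: "finite E" and e: "\<And>i. i \<in> E \<Longrightarrow> e i \<in> H"
    and phi: "\<And>i. i \<in> E \<Longrightarrow> \<phi> i \<in> linear_maps R ?Z ?R"
    and expandZ: "\<And>z. z \<in> H \<Longrightarrow> (\<Oplus>\<^bsub>?Z\<^esub>i\<in>E. \<phi> i z \<odot>\<^bsub>N\<^esub> e i) = z"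
    using dbZ by (auto simp: dual_basis_def)
  have eN: "e i \<in> carrier N" if "i \<in> E" for i using e H that by blast
  have psic: "\<psi> j x \<in> carrier R" if "j \<in> G" "x \<in> carrier N" for j x
    using linear_maps_closed[OF psi] that by fastforce
  have phic: "\<phi> i z \<in> carrier R" if "i \<in> E" "z \<in> H" for i z
    using linear_maps_closed[OF phi] that by fastforce
  have incl: "(\<lambda>z. z) \<in> linear_maps R ?Z N" by (rule linear_mapsI) (use H in auto)
  have sum_eq: "(\<Oplus>\<^bsub>?Z\<^esub>i\<in>E. x i \<odot>\<^bsub>N\<^esub> e i) = (\<Oplus>\<^bsub>N\<^esub>i\<in>E. x i \<odot>\<^bsub>N\<^esub> e i)"
    if x: "x \<in> E \<rightarrow> carrier R" for x
  proof (rule linear_maps_finsum[OF Z N incl E])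
    show "(\<lambda>i. x i \<odot>\<^bsub>N\<^esub> e i) \<in> E \<rightarrow> carrier ?Z" using x e Z.smult_closed by auto
  qed
  define W where "W = {w \<in> E \<rightarrow> carrier R. \<exists>p\<in>linear_maps R N ?R.
    \<forall>z\<in>H. dot R E w (\<lambda>i. \<phi> i z) = p z}"
  have WI: "w \<in> W" if "p \<in> linear_maps R N ?R" "w \<in> E \<rightarrow> carrier R"
    "\<forall>z\<in>H. dot R E w (\<lambda>i. \<phi> i z) = p z" for w p
    unfolding W_def using that by blast
  have W: "vector_submodule R E W"
    unfolding vector_submodule_def
  proof (intro conjI ballI allI impI)
    show "W \<subseteq> E \<rightarrow> carrier R" by (auto simp: W_def)
    show "w \<in> W" if v: "v \<in> W" and w: "\<forall>i\<in>E. w i = v i" for v w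
    proof -
      have "dot R E w (\<lambda>i. \<phi> i z) = dot R E v (\<lambda>i. \<phi> i z)" if "z \<in> H" for z
        using v w phic that by (intro dot_cong) (auto simp: W_def)
      moreover have "w \<in> E \<rightarrow> carrier R" using v w by (auto simp: W_def Pi_iff)
      ultimately show ?thesis using v by (simp add: W_def)
    qed
    show "(\<lambda>_. \<zero>) \<in> W"
    proof -
      have "\<forall>z\<in>H. dot R E (\<lambda>_. \<zero>) (\<lambda>i. \<phi> i z) = \<zero>" using phic by (simp add: dot_zero_left)
      then show ?thesis by (intro WI[OF functional_zero[OF N]]) auto
    qed
    show "(\<lambda>i. v i \<oplus> w i) \<in> W" if vw: "v \<in> W" "w \<in> W" for v w
    proof -
      obtain p q where p: "p \<in> linear_maps R N ?R" "\<forall>z\<in>H. dot R E v (\<lambda>i. \<phi> i z) = p z"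
        and q: "q \<in> linear_maps R N ?R" "\<forall>z\<in>H. dot R E w (\<lambda>i. \<phi> i z) = q z"
        using vw by (auto simp: W_def)
      have vwc: "v \<in> E \<rightarrow> carrier R" "w \<in> E \<rightarrow> carrier R" using vw by (auto simp: W_def)
      have "\<forall>z\<in>H. dot R E (\<lambda>i. v i \<oplus> w i) (\<lambda>i. \<phi> i z) = p z \<oplus> q z"
        using p q vwc phic by (auto simp: dot_add_left)
      then show ?thesis using vwc by (intro WI[OF functional_add[OF N p(1) q(1)]]) auto
    qed
    show "(\<lambda>i. a \<otimes> v i) \<in> W" if a: "a \<in> carrier R" and v: "v \<in> W" for a v
    proof -
      obtain p where p: "p \<in> linear_maps R N ?R" "\<forall>z\<in>H. dot R E v (\<lambda>i. \<phi> i z) = p z"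
        using v by (auto simp: W_def)
      have vc: "v \<in> E \<rightarrow> carrier R" using v by (auto simp: W_def)
      have "\<forall>z\<in>H. dot R E (\<lambda>i. a \<otimes> v i) (\<lambda>i. \<phi> i z) = a \<otimes> p z"
        using p vc phic a E by (auto simp: dot_smult_left)
      then show ?thesis using vc a by (intro WI[OF functional_smult[OF N a p(1)]]) auto
    qed
  qed
  define V where "V = (\<lambda>j i. \<psi> j (e i)) ` G
    \<union> (\<lambda>l i. (if i = l then \<one> else \<zero>) \<ominus> \<phi> l (e i)) ` E"
  have finV: "finite V" using G E by (simp add: V_def)
  have Vc: "V \<subseteq> E \<rightarrow> carrier R"
    using psic phic e eN by (auto simp: V_def)
  have dot_psi: "dot R E (\<lambda>i. \<psi> j (e i)) x = \<psi> j (\<Oplus>\<^bsub>?Z\<^esub>i\<in>E. x i \<odot>\<^bsub>N\<^esub> e i)"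
    if "j \<in> G" "x \<in> E \<rightarrow> carrier R" for j x
    unfolding sum_eq[OF that(2)] using that eN
    by (intro dot_functional[OF N E psi]) auto
  have dot_phi: "dot R E (\<lambda>i. (if i = l then \<one> else \<zero>) \<ominus> \<phi> l (e i)) x
      = x l \<ominus> \<phi> l (\<Oplus>\<^bsub>?Z\<^esub>i\<in>E. x i \<odot>\<^bsub>N\<^esub> e i)"
    if l: "l \<in> E" and x: "x \<in> E \<rightarrow> carrier R" for l x
  proof -
    have "dot R E (\<lambda>i. \<phi> l (e i)) x = \<phi> l (\<Oplus>\<^bsub>?Z\<^esub>i\<in>E. x i \<odot>\<^bsub>?Z\<^esub> e i)"
      using x e by (intro dot_functional[OF Z E phi[OF l]]) auto
    moreover have "dot R E (\<lambda>i. (if i = l then \<one> else \<zero>) \<ominus> \<phi> l (e i)) x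
        = dot R E (\<lambda>i. if i = l then \<one> else \<zero>) x \<ominus> dot R E (\<lambda>i. \<phi> l (e i)) x"
      using x e phic l E by (intro dot_minus_left) auto
    ultimately show ?thesis using dot_unit_vector[OF E l x] by simp
  qed
  have VW: "V \<subseteq> W"
  proof
    fix v assume v: "v \<in> V"
    have phiz: "(\<lambda>i. \<phi> i z) \<in> E \<rightarrow> carrier R" if "z \<in> H" for z using phic that by auto
    have vc: "v \<in> E \<rightarrow> carrier R" using v Vc by blast
    consider j where "j \<in> G" "v = (\<lambda>i. \<psi> j (e i))"
      | l where "l \<in> E" "v = (\<lambda>i. (if i = l then \<one> else \<zero>) \<ominus> \<phi> l (e i))"
      using v by (auto simp: V_def)
    then show "v \<in> W"
    proof cases
      case 1
      then have "\<forall>z\<in>H. dot R E v (\<lambda>i. \<phi> i z) = \<psi> j z"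
        using phiz by (simp add: dot_psi expandZ)
      then show ?thesis by (rule WI[OF psi[OF 1(1)] vc])
    next
      case 2
      then have "\<forall>z\<in>H. dot R E v (\<lambda>i. \<phi> i z) = \<zero>"
        using phiz phic by (simp add: dot_phi expandZ)
      then show ?thesis by (rule WI[OF functional_zero[OF N] vc])
    qed
  qed
  have divisible: "t divides x l"
    if t: "t \<in> carrier R" and x: "x \<in> E \<rightarrow> carrier R"
      and div: "\<forall>v\<in>V. t divides dot R E v x" and l: "l \<in> E" for t x l
  proof -
    define z where "z = (\<Oplus>\<^bsub>?Z\<^esub>i\<in>E. x i \<odot>\<^bsub>N\<^esub> e i)"
    have z: "z \<in> H"
    proof -
      have "z \<in> carrier ?Z" unfolding z_def using x e Z.smult_closed by (intro Z.finsum_closed) auto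
      then show ?thesis by simp
    qed
    have "\<exists>w\<in>H. z = t \<odot>\<^bsub>N\<^esub> w"
    proof -
      have "t divides \<psi> j z" if "j \<in> G" for j
      proof -
        have "(\<lambda>i. \<psi> j (e i)) \<in> V" using that by (auto simp: V_def)
        then have "t divides dot R E (\<lambda>i. \<psi> j (e i)) x" using div by blast
        then show ?thesis using dot_psi[OF that x] by (simp add: z_def)
      qed
      then have "\<forall>j\<in>G. \<exists>b. b \<in> carrier R \<and> \<psi> j z = t \<otimes> b" by (auto dest: dividesD)
      from bchoice[OF this]
      obtain b where b: "\<forall>j\<in>G. b j \<in> carrier R \<and> \<psi> j z = t \<otimes> b j" ..
      let ?w = "\<Oplus>\<^bsub>N\<^esub>j\<in>G. b j \<odot>\<^bsub>N\<^esub> g j"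
      have w: "?w \<in> carrier N" using b g by (intro N.finsum_closed) auto
      have "z = (\<Oplus>\<^bsub>N\<^esub>j\<in>G. \<psi> j z \<odot>\<^bsub>N\<^esub> g j)" using expandN[of z] z H by auto
      also have "\<dots> = (\<Oplus>\<^bsub>N\<^esub>j\<in>G. t \<odot>\<^bsub>N\<^esub> (b j \<odot>\<^bsub>N\<^esub> g j))"
        using b g t by (intro N.finsum_cong') (auto simp: N.smult_assoc1)
      also have "\<dots> = t \<odot>\<^bsub>N\<^esub> ?w"
        using b g t G by (intro N.finsum_smult_ldistr[symmetric]) auto
      finally have zw: "z = t \<odot>\<^bsub>N\<^esub> ?w" .
      \<comment> \<open>For \<open>t = 0\<close> the sum need not lie in \<open>H\<close>, but \<open>z = 0\<close> is then the multiple of \<open>0 \<in> H\<close>.\<close>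
      show ?thesis
      proof (cases "t = \<zero>")
        case True
        have "\<zero>\<^bsub>N\<^esub> \<in> H" using Z.M.zero_closed by simp
        moreover have "z = t \<odot>\<^bsub>N\<^esub> \<zero>\<^bsub>N\<^esub>" using zw w True by simp
        ultimately show ?thesis by blast
      next
        case False
        then have "?w \<in> H" using saturated[OF t _ w] zw z by simp
        with zw show ?thesis by blast
      qed
    qed
    then obtain w where w: "w \<in> H" "z = t \<odot>\<^bsub>N\<^esub> w" by blast
    have "(\<lambda>i. (if i = l then \<one> else \<zero>) \<ominus> \<phi> l (e i)) \<in> V" using l by (auto simp: V_def)
    then have "t divides dot R E (\<lambda>i. (if i = l then \<one> else \<zero>) \<ominus> \<phi> l (e i)) x" using div by blast
    then have "t divides (x l \<ominus> \<phi> l z)" using dot_phi[OF l x] by (simp add: z_def)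
    then obtain c where c: "c \<in> carrier R" "x l \<ominus> \<phi> l z = t \<otimes> c" by (elim dividesE)
    have xl: "x l \<in> carrier R" using x l by blast
    have "\<phi> l z = t \<otimes> \<phi> l w" using linear_maps_smult[OF phi[OF l] t, of w] w by simp
    then have "x l = t \<otimes> c \<oplus> t \<otimes> \<phi> l w"
      using c(2)[symmetric] xl phic[OF l z] by (simp add: minus_eq a_assoc l_neg)
    also have "\<dots> = t \<otimes> (c \<oplus> \<phi> l w)" using t c(1) phic[OF l w(1)] by (simp add: r_distr)
    finally show ?thesis using c(1) phic[OF l w(1)] by (intro dividesI) auto
  qed
  have separating: "\<exists>w\<in>W. dot R E w x \<notin> m"
    if m: "maximalideal m R" and x: "x \<in> E \<rightarrow> carrier R" and k: "k \<in> E" "x k \<notin> m" for m x k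
  proof -
    have prime: "primeideal m R" using m by (rule maximalideal_prime)
    have PVD: "PVD (localize_at R m)" using R m by (simp add: LPVD_def)
    have "\<exists>v\<in>V. dot R E v x \<notin> m"
      using prime PVD_imp_dominated_total[OF prime PVD] E finV Vc divisible x k
      by (rule exists_dot_not_in_maximal)
    then show ?thesis using VW by blast
  qed
  have "\<exists>p\<in>linear_maps R N ?R. \<forall>z\<in>H. \<phi> k z = p z" if k: "k \<in> E" for k
  proof -
    have "(\<lambda>i. if i = k then \<one> else \<zero>) \<in> W" by (rule unit_vectors_mem[OF W E separating k])
    then obtain p where p: "p \<in> linear_maps R N ?R"
      "\<forall>z\<in>H. dot R E (\<lambda>i. if i = k then \<one> else \<zero>) (\<lambda>i. \<phi> i z) = p z" by (auto simp: W_def)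
    have "\<phi> k z = p z" if z: "z \<in> H" for z
      using p(2) z dot_unit_vector[OF E k, of "\<lambda>i. \<phi> i z"] phic by simp
    with p(1) show ?thesis by blast
  qed
  then have "\<forall>k\<in>E. \<exists>p. p \<in> linear_maps R N ?R \<and> (\<forall>z\<in>H. \<phi> k z = p z)" by blast
  from bchoice[OF this]
  obtain p where "\<forall>k\<in>E. p k \<in> linear_maps R N ?R \<and> (\<forall>z\<in>H. \<phi> k z = p k z)" ..
  then have p: "\<And>k. k \<in> E \<Longrightarrow> p k \<in> linear_maps R N ?R"
    "\<And>k z. k \<in> E \<Longrightarrow> z \<in> H \<Longrightarrow> \<phi> k z = p k z" by simp_all
  let ?r = "\<lambda>x. \<Oplus>\<^bsub>?Z\<^esub>i\<in>E. p i x \<odot>\<^bsub>?Z\<^esub> e i"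
  have "?r \<in> linear_maps R N ?Z" by (rule lincomb_linear[OF N Z E p(1)]) (use e in auto)
  moreover have "?r z = z" if z: "z \<in> H" for z
  proof -
    have "?r z = (\<Oplus>\<^bsub>?Z\<^esub>i\<in>E. \<phi> i z \<odot>\<^bsub>?Z\<^esub> e i)"
      using z p phic e Z.smult_closed by (intro Z.finsum_cong') auto
    then show ?thesis using expandZ[OF z] by simp
  qed
  ultimately show ?thesis by (intro bexI[of _ ?r] ballI)
qed

section \<open>Syzygies\<close>

text \<open>
  The target \<open>Q\<close> is torsion-free, so the kernel of \<open>d\<close> is saturated and has a retraction \<open>r\<close>. The map
  \<open>s = 1 - r\<close> kills the kernel and satisfies \<open>d \<circ> s = d\<close>. It therefore induces a section of \<open>d\<close> on the
  image, along which the coordinates \<open>\<psi> j\<close> are pulled back.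
\<close>

lemma LPVD_image_dual_basis:
  fixes R (structure)
  assumes R: "LPVD R" and N: "module R N" and Q: "module R Q" and d: "d \<in> linear_maps R N Q"
    and dbN: "dual_basis R N G g \<psi>" and dbQ: "dual_basis R Q I q \<chi>"
    and Z: "module R (N\<lparr>carrier := module_kernel N Q d\<rparr>)"
    and dbZ: "dual_basis R (N\<lparr>carrier := module_kernel N Q d\<rparr>) E e \<phi>"
  shows "\<exists>\<psi>'. dual_basis R (Q\<lparr>carrier := d ` carrier N\<rparr>) G (\<lambda>j. d (g j)) \<psi>'"
proof -
  let ?H = "module_kernel N Q d"
  let ?Z = "N\<lparr>carrier := ?H\<rparr>"
  let ?I = "Q\<lparr>carrier := d ` carrier N\<rparr>"
  let ?R = "regular_module R"
  interpret domain R using R by (simp add: LPVD_def)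
  interpret N: module R N by (rule N)
  interpret Q: module R Q by (rule Q)
  have I: "module R ?I" using N Q d by (rule image_is_module)
  interpret I: module R ?I by (rule I)
  have HN: "?H \<subseteq> carrier N" by (auto simp: module_kernel_def)
  have saturated: "x \<in> ?H" if "a \<in> carrier R" "a \<noteq> \<zero>" "x \<in> carrier N" "a \<odot>\<^bsub>N\<^esub> x \<in> ?H" for a x
  proof -
    have "a \<odot>\<^bsub>Q\<^esub> d x = \<zero>\<^bsub>Q\<^esub>"
      using that linear_maps_smult[OF d] by (simp add: module_kernel_def)
    then have "d x = \<zero>\<^bsub>Q\<^esub>"
      by (rule dual_basis_torsion_free[OF Q dbQ that(1,2) linear_maps_closed[OF d that(3)]])
    then show ?thesis using that(3) by (simp add: module_kernel_def)
  qed
  have "\<exists>r\<in>linear_maps R N ?Z. \<forall>z\<in>?H. r z = z"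
    using R N HN Z dbN dbZ saturated by (rule LPVD_saturated_retraction)
  then obtain r where r: "r \<in> linear_maps R N ?Z" and rH: "\<And>z. z \<in> ?H \<Longrightarrow> r z = z" by blast
  have rc: "r x \<in> ?H" if "x \<in> carrier N" for x using linear_maps_closed[OF r that] by simp
  have rN: "r \<in> linear_maps R N N"
    using rc HN linear_maps_add[OF r] linear_maps_smult[OF r] by (intro linear_mapsI) auto
  have rNc: "r x \<in> carrier N" if "x \<in> carrier N" for x using rc[OF that] HN by blast
  define s where "s x = x \<ominus>\<^bsub>N\<^esub> r x" for x
  have s: "s \<in> linear_maps R N N"
  proof (rule linear_mapsI)
    show "s x \<in> carrier N" if "x \<in> carrier N" for x using that rNc by (simp add: s_def)
    show "s (x \<oplus>\<^bsub>N\<^esub> y) = s x \<oplus>\<^bsub>N\<^esub> s y" if "x \<in> carrier N" "y \<in> carrier N" for x y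
      using that rNc linear_maps_add[OF rN]
      by (simp add: s_def N.M.minus_eq N.M.minus_add N.M.a_ac)
    show "s (a \<odot>\<^bsub>N\<^esub> x) = a \<odot>\<^bsub>N\<^esub> s x" if "a \<in> carrier R" "x \<in> carrier N" for a x
      using that rNc linear_maps_smult[OF rN]
      by (simp add: s_def N.M.minus_eq N.smult_r_distr N.smult_r_minus)
  qed
  have ds: "d (s x) = d x" if x: "x \<in> carrier N" for x
  proof -
    have "d (s x) = d x \<ominus>\<^bsub>Q\<^esub> d (r x)"
      unfolding s_def by (rule linear_maps_minus[OF N Q d x rNc[OF x]])
    also have "d (r x) = \<zero>\<^bsub>Q\<^esub>" using rc[OF x] by (simp add: module_kernel_def)
    finally show ?thesis using linear_maps_closed[OF d x] by (simp add: Q.M.minus_eq)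
  qed
  have s_ker: "s x = \<zero>\<^bsub>N\<^esub>" if "x \<in> carrier N" "d x = \<zero>\<^bsub>Q\<^esub>" for x
  proof -
    have "r x = x" using that rH by (simp add: module_kernel_def)
    then show ?thesis using that by (simp add: s_def N.M.minus_eq N.M.r_neg)
  qed
  have G: "finite G" and g: "\<And>j. j \<in> G \<Longrightarrow> g j \<in> carrier N"
    and psi: "\<And>j. j \<in> G \<Longrightarrow> \<psi> j \<in> linear_maps R N ?R"
    and expand: "\<And>x. x \<in> carrier N \<Longrightarrow> (\<Oplus>\<^bsub>N\<^esub>j\<in>G. \<psi> j x \<odot>\<^bsub>N\<^esub> g j) = x"
    using dbN by (auto simp: dual_basis_def)
  have psic: "\<psi> j x \<in> carrier R" if "j \<in> G" "x \<in> carrier N" for j x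
    using linear_maps_closed[OF psi[OF that(1)] that(2)] by simp
  have "\<exists>f. f \<in> linear_maps R ?I ?R \<and> (\<forall>x\<in>carrier N. f (d x) = \<psi> j (s x))" if j: "j \<in> G" for j
    using linear_map_factors_through_image[OF N Q regular_module d linear_maps_comp[OF s psi[OF j]]]
      s_ker linear_maps_zero[OF N regular_module psi[OF j]] by auto
  then have "\<forall>j\<in>G. \<exists>f. f \<in> linear_maps R ?I ?R \<and> (\<forall>x\<in>carrier N. f (d x) = \<psi> j (s x))" by blast
  from bchoice[OF this] obtain \<psi>'
    where "\<forall>j\<in>G. \<psi>' j \<in> linear_maps R ?I ?R \<and> (\<forall>x\<in>carrier N. \<psi>' j (d x) = \<psi> j (s x))" ..
  then have psi': "\<And>j. j \<in> G \<Longrightarrow> \<psi>' j \<in> linear_maps R ?I ?R"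
    and psi'_eq: "\<And>j x. j \<in> G \<Longrightarrow> x \<in> carrier N \<Longrightarrow> \<psi>' j (d x) = \<psi> j (s x)" by simp_all
  have dI: "d \<in> linear_maps R N ?I"
    using linear_maps_add[OF d] linear_maps_smult[OF d] by (intro linear_mapsI) auto
  have "y = (\<Oplus>\<^bsub>?I\<^esub>j\<in>G. \<psi>' j y \<odot>\<^bsub>?I\<^esub> d (g j))" if y: "y \<in> carrier ?I" for y
  proof -
    obtain x where x: "x \<in> carrier N" "y = d x" using y by auto
    have sx: "s x \<in> carrier N" using linear_maps_closed[OF s x(1)] .
    have "y = d (\<Oplus>\<^bsub>N\<^esub>j\<in>G. \<psi> j (s x) \<odot>\<^bsub>N\<^esub> g j)" using expand[OF sx] ds x by simp
    also have "\<dots> = (\<Oplus>\<^bsub>?I\<^esub>j\<in>G. d (\<psi> j (s x) \<odot>\<^bsub>N\<^esub> g j))"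
      using psic g sx by (intro linear_maps_finsum[OF N I dI G]) auto
    also have "\<dots> = (\<Oplus>\<^bsub>?I\<^esub>j\<in>G. \<psi>' j y \<odot>\<^bsub>?I\<^esub> d (g j))"
    proof (rule I.finsum_cong'[OF refl])
      show "(\<lambda>j. \<psi>' j y \<odot>\<^bsub>?I\<^esub> d (g j)) \<in> G \<rightarrow> carrier ?I"
      proof
        fix j assume j: "j \<in> G"
        have "\<psi>' j y \<in> carrier R" using linear_maps_closed[OF psi'[OF j] y] by simp
        then show "\<psi>' j y \<odot>\<^bsub>?I\<^esub> d (g j) \<in> carrier ?I"
          using g[OF j] by (intro I.smult_closed) auto
      qed
      fix j assume j: "j \<in> G"
      show "d (\<psi> j (s x) \<odot>\<^bsub>N\<^esub> g j) = \<psi>' j y \<odot>\<^bsub>?I\<^esub> d (g j)"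
        using j x sx psi'_eq linear_maps_smult[OF d psic[OF j sx] g[OF j]] by simp
    qed
    finally show ?thesis .
  qed
  then have "dual_basis R ?I G (\<lambda>j. d (g j)) \<psi>'"
    using G g psi' unfolding dual_basis_def by auto
  then show ?thesis by blast
qed

text \<open>
  Downward induction: the image of \<open>d n\<close> is zero, and by exactness the image of \<open>d (i + 1)\<close> is the kernel
  of \<open>d i\<close>.
\<close>

lemma resolution_image_dual_basis:
  fixes P :: "nat \<Rightarrow> ('a, 'p) module" and R :: "('a, 'r) ring_scheme"
  assumes R: "LPVD R" and res: "resolution R n P d e M"
    and proj: "\<And>i. projective R (P i)" and fg: "\<And>i. finitely_generated R (P i)"
    and "i \<le> n"
  shows "\<exists>(E :: 'p set) b \<phi>. dual_basis R ((P i)\<lparr>carrier := d i ` carrier (P (Suc i))\<rparr>) E b \<phi>"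
  using \<open>i \<le> n\<close>
proof (induction rule: inc_induct)
  have P: "module R (P i)" for i using res by (simp add: resolution_def)
  have d: "d i \<in> linear_maps R (P (Suc i)) (P i)" for i using res by (simp add: resolution_def)
  have exact: "d (Suc i) ` carrier (P (Suc (Suc i))) = module_kernel (P (Suc i)) (P i) (d i)" for i
    using res by (simp add: resolution_def)
  have image: "module R ((P i)\<lparr>carrier := d i ` carrier (P (Suc i))\<rparr>)" for i
    by (rule image_is_module[OF P P d])
  {
    case base
    have "carrier (P (Suc n)) = {\<zero>\<^bsub>P (Suc n)\<^esub>}" using res by (simp add: resolution_def)
    then have "d n ` carrier (P (Suc n)) = {\<zero>\<^bsub>P n\<^esub>}"
      using linear_maps_zero[OF P P d] by simp
    then show ?case using dual_basis_zero_module[OF image] by fastforce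
  next
    case (step i)
    obtain G :: "'p set" and g \<psi> where dbN: "dual_basis R (P (Suc i)) G g \<psi>"
      using dual_basis_of_projective[OF proj fg] by blast
    obtain I :: "'p set" and q \<chi> where dbQ: "dual_basis R (P i) I q \<chi>"
      using dual_basis_of_projective[OF proj fg] by blast
    obtain E :: "'p set" and b \<phi> where
      "dual_basis R ((P (Suc i))\<lparr>carrier := d (Suc i) ` carrier (P (Suc (Suc i)))\<rparr>) E b \<phi>"
      using step.IH by blast
    then have "\<exists>\<psi>'. dual_basis R ((P i)\<lparr>carrier := d i ` carrier (P (Suc i))\<rparr>) G (\<lambda>j. d i (g j)) \<psi>'"
      using image[of "Suc i"] unfolding exact
      by (intro LPVD_image_dual_basis[OF R P P d dbN dbQ])
    then show ?case by blast
  }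
qed

text \<open>
  All terms of the resolution \<open>0 \<rightarrow> ker e \<rightarrow> P0 \<rightarrow> M \<rightarrow> 0\<close>, zeros included, are realised as submodules of
  \<open>P0\<close>, so that every differential is an inclusion.
\<close>

lemma projective_dimension_le_1:
  fixes M :: "('a, 'm) module" and P0 :: "('a, ('a, 'm) res_elem) module"
  assumes M: "module R M" and P0: "projective R P0"
    and e: "e \<in> linear_maps R P0 M" "e ` carrier P0 = carrier M"
    and K: "projective R (P0\<lparr>carrier := module_kernel P0 M e\<rparr>)"
  shows "projective_dimension R M \<le> 1"
proof -
  have mP0: "module R P0" and mK: "module R (P0\<lparr>carrier := module_kernel P0 M e\<rparr>)"
    using P0 K by (auto simp: projective_def)
  interpret P0: module R P0 by (rule mP0)
  have "submodule {\<zero>\<^bsub>P0\<^esub>} R P0" by (rule P0.submoduleI) auto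
  then have mO: "module R (P0\<lparr>carrier := {\<zero>\<^bsub>P0\<^esub>}\<rparr>)"
    using mP0 by (rule submodule.submodule_is_module)
  define H where "H i = (if i = 0 then carrier P0 else if i = 1 then module_kernel P0 M e
    else {\<zero>\<^bsub>P0\<^esub>})" for i :: nat
  define P where "P i = P0\<lparr>carrier := H i\<rparr>" for i
  have P_simps: "P 0 = P0" "P (Suc 0) = P0\<lparr>carrier := module_kernel P0 M e\<rparr>"
    "P (Suc (Suc i)) = P0\<lparr>carrier := {\<zero>\<^bsub>P0\<^esub>}\<rparr>" for i
    by (simp_all add: P_def H_def)
  have cases: "i = 0 \<or> i = Suc 0 \<or> (\<exists>j. i = Suc (Suc j))" for i :: nat by presburger
  have mP: "module R (P i)" for i
    using cases[of i] mP0 mK mO by (auto simp: P_simps)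
  have proj: "projective R (P i)" for i
    using cases[of i] P0 K projective_of_dual_basis[OF mO dual_basis_zero_module[OF mO]]
    by (auto simp: P_simps)
  have zK: "\<zero>\<^bsub>P0\<^esub> \<in> module_kernel P0 M e"
    using linear_maps_zero[OF mP0 M e(1)] by (simp add: module_kernel_def)
  have sub: "carrier (P (Suc i)) \<subseteq> carrier (P i)" for i
    using cases[of i] zK by (auto simp: P_simps module_kernel_def)
  have "resolution R 1 P (\<lambda>_ x. x) e M"
    unfolding resolution_def
  proof (intro conjI allI impI)
    show "(\<lambda>x. x) \<in> linear_maps R (P (Suc i)) (P i)" for i
      using sub[of i] by (intro linear_mapsI) (auto simp: P_def)
    show "carrier (P i) = {\<zero>\<^bsub>P i\<^esub>}" if "1 < i" for i
      using that by (simp add: P_def H_def)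
    show "(\<lambda>x. x) ` carrier (P (Suc (Suc i))) = module_kernel (P (Suc i)) (P i) (\<lambda>x. x)" for i
      using cases[of i] zK by (auto simp: P_simps module_kernel_def)
  qed (use M mP e in \<open>simp_all add: P_simps\<close>)
  with proj have "enat 1 \<in> {enat n | n. \<exists>(P :: nat \<Rightarrow> ('a, ('a, 'm) res_elem) module) d e.
      resolution R n P d e M \<and> (\<forall>i. projective R (P i))}" by blast
  then show ?thesis unfolding projective_dimension_def one_enat_def by (rule Inf_lower)
qed

theorem corollary3p9:
  fixes R :: "('a, 'r) ring_scheme"
  assumes "LPVD R"
  shows "fPD TYPE('m) R \<le> 1"
  unfolding fPD_def
proof (rule Sup_least)
  fix x assume "x \<in> {projective_dimension R M | M :: ('a, 'm) module.
    module R M \<and> has_finite_projective_resolution R M}"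
  then obtain M :: "('a, 'm) module" where x: "x = projective_dimension R M"
    and "has_finite_projective_resolution R M" by blast
  then obtain n and P :: "nat \<Rightarrow> ('a, ('a, 'm) res_elem) module" and d e
    where res: "resolution R n P d e M"
      and proj: "\<And>i. projective R (P i)" and fg: "\<And>i. finitely_generated R (P i)"
    unfolding has_finite_projective_resolution_def by blast
  have M: "module R M" and e: "e \<in> linear_maps R (P 0) M" "e ` carrier (P 0) = carrier M"
    and exact: "d 0 ` carrier (P (Suc 0)) = module_kernel (P 0) M e"
    and P: "\<And>i. module R (P i)" and d: "d 0 \<in> linear_maps R (P (Suc 0)) (P 0)"
    using res by (simp_all add: resolution_def)
  obtain E :: "('a, 'm) res_elem set" and b \<phi> where
    "dual_basis R ((P 0)\<lparr>carrier := d 0 ` carrier (P (Suc 0))\<rparr>) E b \<phi>"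
    using resolution_image_dual_basis[OF assms res proj fg le0] by blast
  then have "projective R ((P 0)\<lparr>carrier := d 0 ` carrier (P (Suc 0))\<rparr>)"
    by (rule projective_of_dual_basis[OF image_is_module[OF P P d]])
  then show "x \<le> 1"
    unfolding x exact by (rule projective_dimension_le_1[OF M proj e])
qed

end
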